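(* Let $n,m$ be positive integers. Regard $\mathrm{Lag}^{\mathbb R}(\mathbb R^{2n})$ as a subspace of $\mathrm{Lag}^{\mathbb C}(\mathbb R^{2(n+m)})$ via the embedding described in the context. Then the pair $\big(\mathrm{Lag}^{\mathbb C}(\mathbb R^{2(n+m)}),\mathrm{Lag}^{\mathbb R}(\mathbb R^{2n})\big)$ satisfies the homotopy extension property.
   Context: For $N\ge1$, $\mathbb R^{2N}$ carries a nondegenerate antisymmetric bilinear form $\omega$ with a fixed Darboux basis $e_1,\dots,e_N,f_1,\dots,f_N$ ($\omega(e_j,e_k)=\omega(f_j,f_k)=0$, $\omega(e_j,f_k)=\delta_{jk}$), and $\omega^{\mathbb C}$ is its $\mathbb C$-bilinear extension to $\mathbb C^{2N}=\mathbb R^{2N}\otimes_{\mathbb R}\mathbb C$. $\mathrm{Lag}^{\mathbb R}(\mathbb R^{2N})$ is the Grassmannian manifold of $N$-dimensional real subspaces of $\mathbb R^{2N}$ on which $\omega$ vanishes; $\mathrm{Lag}^{\mathbb C}(\mathbb R^{2N})$ is the Grassmannian manifold of $N$-dimensional complex subspaces of $\mathbb C^{2N}$ on which $\omega^{\mathbb C}$ vanishes. Embedding: let $\iota_{n,m}:\mathbb C^{2n}\hookrightarrow\mathbb C^{2(n+m)}$ be the linear map $e_i\mapsto e_{i+m}$, $f_i\mapsto f_{i+m}$, and let $I_{n,m}:\mathrm{Lag}^{\mathbb C}(\mathbb R^{2n})\hookrightarrow\mathrm{Lag}^{\mathbb C}(\mathbb R^{2(n+m)})$, $I_{n,m}(\Gamma)=\mathrm{span}_{\mathbb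 C}\{e_1,\dots,e_m\}\oplus\iota_{n,m}(\Gamma)$. $\mathrm{Lag}^{\mathbb R}(\mathbb R^{2n})$ is identified with its image in $\mathrm{Lag}^{\mathbb C}(\mathbb R^{2(n+m)})$ under $L\mapsto I_{n,m}(L\otimes_{\mathbb R}\mathbb C)$. *)

theory Defs
  imports "HOL-Analysis.Analysis"
begin

text \<open>Coordinates with respect to the Darboux basis \<open>e\<^sub>1, \<dots>, e\<^sub>N, f\<^sub>1, \<dots>, f\<^sub>N\<close>, where \<open>'n\<close> is an
  index type with \<open>N\<close> elements. The scalars \<open>'a\<close> are \<open>real\<close> or \<open>complex\<close>.\<close>

definition e_vec :: "'n::finite \<Rightarrow> 'a::field ^ ('n + 'n)" where
  "e_vec j = axis (Inl j) 1"

definition f_vec :: "'n::finite \<Rightarrow> 'a::field ^ ('n + 'n)" where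
  "f_vec j = axis (Inr j) 1"

definition omega :: "'a::field ^ ('n::finite + 'n) \<Rightarrow> 'a ^ ('n + 'n) \<Rightarrow> 'a" where
  "omega x y = (\<Sum>j\<in>UNIV. x $ Inl j * y $ Inr j - x $ Inr j * y $ Inl j)"

lemma omega_basis:
  "omega (e_vec j) (e_vec k) = 0"
  "omega (f_vec j) (f_vec k) = 0"
  "omega (e_vec j) (f_vec k) = (if j = k then 1 else 0)"
proof -
  have *: "e_vec j $ Inl i = (if i = j then 1 else 0)" "e_vec j $ Inr i = 0"
    "f_vec j $ Inl i = 0" "f_vec j $ Inr i = (if i = j then 1 else 0)" for i j :: "'n::finite"
    by (simp_all add: e_vec_def f_vec_def axis_def)
  show "omega (e_vec j) (e_vec k) = 0" "omega (f_vec j) (f_vec k) = 0"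
    "omega (e_vec j) (f_vec k) = (if j = k then 1 else 0)"
    by (simp_all add: omega_def * sum.delta if_distrib[of "\<lambda>x. x * _"] cong: if_cong)
qed

lemma omega_antisym: "omega y x = - omega x y"
  unfolding omega_def sum_negf[symmetric] by (rule sum.cong) (auto simp: algebra_simps)

lemma omega_add_left: "omega (x + y) z = omega x z + omega y z"
  unfolding omega_def sum.distrib[symmetric] by (rule sum.cong) (auto simp: algebra_simps)

lemma omega_scale_left: "omega (c *s x) y = c * omega x y"
  unfolding omega_def sum_distrib_left by (rule sum.cong) (auto simp: algebra_simps)

definition of_real_vec :: "real ^ 'k \<Rightarrow> complex ^ 'k" where
  "of_real_vec x = (\<chi> i. complex_of_real (x $ i))"

text \<open>Together with bilinearity, this says that \<open>omega\<close> over \<open>complex\<close> is the complex bilinear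
  extension of \<open>omega\<close> over \<open>real\<close>.\<close>

lemma omega_of_real_vec: "omega (of_real_vec x) (of_real_vec y) = complex_of_real (omega x y)"
  by (simp add: omega_def of_real_vec_def)

definition lagrangians :: "('a::field ^ ('n::finite + 'n)) set set" where
  "lagrangians = {L. vec.subspace L \<and> vec.dim L = CARD('n) \<and> (\<forall>x\<in>L. \<forall>y\<in>L. omega x y = 0)}"

definition quotient_topology :: "'a topology \<Rightarrow> ('a \<Rightarrow> 'b) \<Rightarrow> 'b topology" where
  "quotient_topology X f =
     topology (\<lambda>U. U \<subseteq> f ` topspace X \<and> openin X {x \<in> topspace X. f x \<in> U})"

lemma openin_quotient_topology:
  "openin (quotient_topology X f) U \<longleftrightarrow>
     U \<subseteq> f ` topspace X \<and> openin X {x \<in> topspace X. f x \<in> U}"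
proof -
  have "istopology (\<lambda>U. U \<subseteq> f ` topspace X \<and> openin X {x \<in> topspace X. f x \<in> U})"
    unfolding istopology_def
  proof (intro conjI allI impI)
    fix S T
    assume "S \<subseteq> f ` topspace X \<and> openin X {x \<in> topspace X. f x \<in> S}"
      and "T \<subseteq> f ` topspace X \<and> openin X {x \<in> topspace X. f x \<in> T}"
    moreover have "{x \<in> topspace X. f x \<in> S \<inter> T} =
        {x \<in> topspace X. f x \<in> S} \<inter> {x \<in> topspace X. f x \<in> T}" by auto
    ultimately show "S \<inter> T \<subseteq> f ` topspace X" "openin X {x \<in> topspace X. f x \<in> S \<inter> T}"
      by auto
  next
    fix \<K>
    assume *: "\<forall>K\<in>\<K>. K \<subseteq> f ` topspace X \<and> openin X {x \<in> topspace X. f x \<in> K}"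
    then show "\<Union>\<K> \<subseteq> f ` topspace X" by blast
    have "{x \<in> topspace X. f x \<in> \<Union>\<K>} = (\<Union>K\<in>\<K>. {x \<in> topspace X. f x \<in> K})" by auto
    with * show "openin X {x \<in> topspace X. f x \<in> \<Union>\<K>}" by auto
  qed
  then show ?thesis
    by (simp add: quotient_topology_def)
qed

lemma topspace_quotient_topology: "topspace (quotient_topology X f) = f ` topspace X"
proof -
  have "openin (quotient_topology X f) (f ` topspace X)"
    by (auto simp: openin_quotient_topology Collect_conj_eq intro: back_subst[of "openin X"])
  moreover have "U \<subseteq> f ` topspace X" if "openin (quotient_topology X f) U" for U
    using that by (simp add: openin_quotient_topology)
  ultimately show ?thesis
    by (metis openin_subset openin_topspace subset_antisym)
qed

lemma quotient_map_quotient_topology: "quotient_map X (quotient_topology X f) f"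
  by (simp add: quotient_map_def topspace_quotient_topology openin_quotient_topology)

text \<open>The Grassmannian of \<open>K\<close>-dimensional subspaces, with \<open>K = CARD('k)\<close>, as the quotient of the
  open set of matrices with linearly independent columns: a frame is sent to its column span.\<close>

definition frames :: "('a::real_normed_field ^ 'k ^ 'd) set" where
  "frames = {A. inj ((*v) A)}"

definition grassmannian_topology ::
    "'k::finite itself \<Rightarrow> ('a::real_normed_field ^ 'd::finite) set topology" where
  "grassmannian_topology _ =
     quotient_topology (top_of_set (frames :: ('a ^ 'k ^ 'd) set)) (\<lambda>A. range ((*v) A))"

definition lagrangian_topology :: "('a::real_normed_field ^ ('n::finite + 'n)) set topology" where
  "lagrangian_topology = subtopology (grassmannian_topology TYPE('n)) lagrangians"

lemma topspace_grassmannian_topology: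
  "topspace (grassmannian_topology TYPE('k::finite) :: ('a::real_normed_field ^ 'd::finite) set topology)
     = {S. vec.subspace S \<and> vec.dim S = CARD('k)}"
proof -
  have "range ((*v) A) \<in> {S. vec.subspace S \<and> vec.dim S = CARD('k)}"
    if "inj ((*v) A)" for A :: "'a ^ 'k ^ 'd"
  proof -
    have "vec.dim (range ((*v) A)) = vec.dim (UNIV :: ('a ^ 'k) set)"
      using that by (intro vec.dim_image_eq matrix_vector_mul_linear_gen) auto
    then show ?thesis
      by (simp add: vec.dim_UNIV card_cart_basis vec.subspace_UNIV
          vec.linear_subspace_image[OF matrix_vector_mul_linear_gen])
  qed
  moreover have "S \<in> (\<lambda>A. range ((*v) A)) ` (frames :: ('a ^ 'k ^ 'd) set)"
    if S: "vec.subspace S" "vec.dim S = CARD('k)" for S :: "('a ^ 'd) set"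
  proof -
    obtain B where B: "B \<subseteq> S" "vec.independent B" "S \<subseteq> vec.span B" "card B = CARD('k)"
      using vec.basis_exists[of S] S(2) by metis
    have finB: "finite B" using B(2) by (rule vec.finiteI_independent)
    then obtain h :: "'k \<Rightarrow> 'a ^ 'd" where h: "bij_betw h UNIV B"
      using B(4) by (metis finite finite_same_card_bij)
    then have injh: "inj h" and Bh: "B = range h" by (auto simp: bij_betw_def)
    define A :: "'a ^ 'k ^ 'd" where "A = (\<chi> i j. h j $ i)"
    have col: "column j A = h j" for j by (simp add: A_def column_def vec_eq_iff)
    have mult: "A *v x = (\<Sum>j\<in>UNIV. x $ j *s h j)" for x
      by (simp add: matrix_mult_sum col)
    have "c j = 0" if c: "(\<Sum>j\<in>UNIV. c j *s h j) = 0" for c :: "'k \<Rightarrow> 'a" and j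
    proof -
      have "(\<Sum>v\<in>B. c (inv h v) *s v) = 0"
        using c injh by (simp add: Bh sum.reindex)
      then have "c (inv h (h j)) = 0"
        using vec.independentD[OF B(2) finB subset_refl, of "\<lambda>v. c (inv h v)"] Bh by blast
      then show ?thesis using injh by simp
    qed
    then have "inj ((*v) A)"
      by (simp add: col flip: matrix_left_invertible_injective,
          simp add: matrix_left_invertible_independent_columns col)
    moreover have "range ((*v) A) = S"
    proof
      show "range ((*v) A) \<subseteq> S"
        using B(1) Bh by (auto simp: mult intro!: vec.subspace_sum[OF S(1)] vec.subspace_scale[OF S(1)])
      have "h j \<in> range ((*v) A)" for j
      proof -
        have "A *v axis j 1 = h j"
          by (simp add: vec_eq_iff A_def matrix_vector_mult_def axis_def if_distrib cong: if_cong)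
        then show ?thesis by (metis rangeI)
      qed
      then have "vec.span B \<subseteq> range ((*v) A)"
        by (intro vec.span_minimal vec.linear_subspace_image[OF matrix_vector_mul_linear_gen])
          (auto simp: Bh vec.subspace_UNIV)
      with B(3) show "S \<subseteq> range ((*v) A)" by blast
    qed
    ultimately show ?thesis by (auto simp: frames_def)
  qed
  ultimately show ?thesis
    unfolding grassmannian_topology_def topspace_quotient_topology by (auto simp: frames_def)
qed

lemma topspace_lagrangian_topology: "topspace lagrangian_topology = lagrangians"
  by (auto simp: lagrangian_topology_def topspace_grassmannian_topology lagrangians_def)

definition complexification :: "(real ^ 'd::finite) set \<Rightarrow> (complex ^ 'd) set" where
  "complexification L = vec.span (of_real_vec ` L)"

text \<open>The index type \<open>'m + 'n\<close> lists the \<open>m\<close> additional indices first, so that \<open>Inr i\<close> stands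
  for the shifted index \<open>i + m\<close>.\<close>

definition iota :: "complex ^ ('n::finite + 'n) \<Rightarrow> complex ^ (('m::finite + 'n) + ('m + 'n))" where
  "iota x = (\<Sum>i\<in>UNIV. x $ Inl i *s e_vec (Inr i) + x $ Inr i *s f_vec (Inr i))"

definition lag_embed ::
    "(complex ^ ('n::finite + 'n)) set \<Rightarrow> (complex ^ (('m::finite + 'n) + ('m + 'n))) set" where
  "lag_embed \<Gamma> = {u + iota v | u v. u \<in> vec.span (range (\<lambda>i. e_vec (Inl i))) \<and> v \<in> \<Gamma>}"

text \<open>The homotopy extension property of the pair \<open>(X, A)\<close> with respect to all target spaces
  whose underlying set is contained in the type \<open>'b\<close>.\<close>

definition homotopy_extension_property :: "'b itself \<Rightarrow> 'a topology \<Rightarrow> 'a set \<Rightarrow> bool" where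
  "homotopy_extension_property _ X A \<longleftrightarrow>
     A \<subseteq> topspace X \<and>
     (\<forall>(Y :: 'b topology) f H.
        continuous_map X Y f \<and>
        continuous_map (prod_topology (subtopology X A) (top_of_set {0..1::real})) Y H \<and>
        (\<forall>a\<in>A. H (a, 0) = f a) \<longrightarrow>
        (\<exists>K. continuous_map (prod_topology X (top_of_set {0..1::real})) Y K \<and>
             (\<forall>x\<in>topspace X. K (x, 0) = f x) \<and>
             (\<forall>a\<in>A. \<forall>t\<in>{0..1}. K (a, t) = H (a, t))))"

end

theory Submission
  imports Defs
begin

text \<open>Let \<open>\<tau>\<close> be the antilinear map with \<open>\<omega>(x, y) = \<langle>\<tau> x, y\<rangle>\<close>; it satisfies \<open>\<tau>\<^sup>2 = -1\<close>. A Lagrangian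
  \<open>\<Gamma>\<close> gives an orthogonal splitting \<open>\<Gamma> \<oplus> \<tau> \<Gamma>\<close>, and the involution \<open>R\<close> that is \<open>1\<close> on \<open>\<Gamma>\<close> and
  \<open>-1\<close> on \<open>\<tau> \<Gamma>\<close> identifies the Lagrangian Grassmannian with the compact set of self-adjoint \<open>R\<close>
  with \<open>R \<tau> = - \<tau> R\<close> and \<open>R\<^sup>2 = 1\<close>. The embedded real Lagrangians correspond to those \<open>R\<close> that moreover
  commute with complex conjugation and fix \<open>e\<^sub>1, \<dots>, e\<^sub>m\<close>. In both cases the conditions other than
  \<open>R\<^sup>2 = 1\<close> cut out a closed convex set stable under Newton's iteration for the sign function. This
  iteration converges uniformly near the involutions and so retracts a neighbourhood onto them: both
  spaces are compact ANRs, and a pair of compact ANRs has the homotopy extension property.\<close>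

section \<open>Homotopy extension for compact ANR pairs\<close>

text \<open>The bottom and the side cylinder are closed ANRs that meet in the ANR
  \<open>Q \<times> {0}\<close>, so their union \<open>?T\<close> is an ANR and hence a retract of
  some relatively open \<open>V\<close>. By compactness the points whose time segment leaves
  \<open>V\<close> form a closed set disjoint from \<open>Q\<close>, and a Urysohn function freezes
  time there.\<close>

lemma compact_ANR_pair_retract:
  fixes M Q :: "'e::euclidean_space set"
  assumes "compact M" "compact Q" "Q \<subseteq> M" "ANR M" "ANR Q"
  shows "(M \<times> {0} \<union> Q \<times> {0..1}) retract_of (M \<times> {0..1::real})"
proof -
  let ?T = "M \<times> {0} \<union> Q \<times> {0..1::real}"
  let ?C = "M \<times> {0..1::real}"
  have sub: "?T \<subseteq> ?C" using assms(3) by auto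
  have I: "M \<times> {0} \<inter> Q \<times> {0..1} = Q \<times> {0::real}" using assms(3) by auto
  have cl: "closed (M \<times> {0::real})" "closed (Q \<times> {0..1::real})"
    using assms by (simp_all add: closed_Times compact_imp_closed)
  have "ANR ?T"
    by (rule ANR_closed_Un[OF cl])
      (auto simp: I assms convex_imp_ANR ANR_singleton intro!: ANR_Times)
  moreover have "closedin (top_of_set ?C) ?T"
    by (rule closed_subset[OF sub closed_Un[OF cl]])
  ultimately obtain V where V: "openin (top_of_set ?C) V" "?T retract_of V"
    by (rule ANR_imp_neighbourhood_retract)
  then obtain r where TV: "?T \<subseteq> V" and r: "continuous_on V r" "r \<in> V \<rightarrow> ?T" "\<And>x. x \<in> ?T \<Longrightarrow> r x = x"
    unfolding retract_of_def retraction_def by blast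
  have VC: "V \<subseteq> ?C" using V(1) openin_imp_subset by blast
  have "compact (?C - V)"
    using V(1) assms(1)
    by (metis closedin_compact closedin_diff closedin_topspace compact_Icc compact_Times
        topspace_euclidean_subtopology)
  then have cD: "compact (fst ` (?C - V))"
    by (intro compact_continuous_image continuous_intros)
  have "Q \<inter> fst ` (?C - V) = {}" using TV by auto
  then obtain \<phi> :: "'e \<Rightarrow> real" where \<phi>: "continuous_on UNIV \<phi>" "\<And>x. \<phi> x \<in> closed_segment 1 0"
    "\<And>x. x \<in> Q \<Longrightarrow> \<phi> x = 1" "\<And>x. x \<in> fst ` (?C - V) \<Longrightarrow> \<phi> x = 0"
    using Urysohn[of Q "fst ` (?C - V)" "1::real" 0] assms(2) cD compact_imp_closed by metis
  have \<phi>01: "0 \<le> \<phi> x" "\<phi> x \<le> 1" for x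
    using \<phi>(2)[of x] by (auto simp: closed_segment_eq_real_ivl)
  \<comment> \<open>Rescaling the time by \<open>\<phi>\<close> keeps every trajectory inside \<open>V\<close> without moving points of the subset.\<close>
  have inV: "(x, t * \<phi> x) \<in> V" if "x \<in> M" "0 \<le> t" "t \<le> 1" for x t
  proof (cases "x \<in> fst ` (?C - V)")
    case True
    then show ?thesis using \<phi>(4)[OF True] TV that by auto
  next
    case False
    have "(x, t * \<phi> x) \<in> ?C"
      using that \<phi>01[of x] by (auto intro: mult_le_one)
    with False show ?thesis by force
  qed
  have "retraction ?C ?T (\<lambda>p. r (fst p, snd p * \<phi> (fst p)))"
    unfolding retraction_def
  proof (intro conjI)
    have *: "continuous_on ?C (\<lambda>p. (fst p, snd p * \<phi> (fst p)))"
      by (intro continuous_intros continuous_on_compose2[OF \<phi>(1)]) auto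
    show "continuous_on ?C (\<lambda>p. r (fst p, snd p * \<phi> (fst p)))"
      by (rule continuous_on_compose2[OF r(1) *]) (auto intro: inV)
    show "(\<lambda>p. r (fst p, snd p * \<phi> (fst p))) \<in> ?C \<rightarrow> ?T"
      using inV r(2) by (fastforce simp: Pi_iff)
    show "\<forall>x\<in>?T. r (fst x, snd x * \<phi> (fst x)) = x"
      using r(3) \<phi>(3) by auto
  qed (rule sub)
  then show ?thesis unfolding retract_of_def by blast
qed

text \<open>The homeomorphism moves the problem into the cylinder over \<open>M\<close>. There the
  initial map and the homotopy glue to a map on the bottom and the side cylinder, and composing it
  with a retraction of the cylinder gives the extension.\<close>

lemma homotopy_extension_property_compact_ANR:
  fixes M :: "'e::euclidean_space set"
  assumes hom: "homeomorphic_map X (top_of_set M) \<phi>"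
    and A: "A \<subseteq> topspace X"
    and M: "compact M" "ANR M" and Q: "compact (\<phi> ` A)" "ANR (\<phi> ` A)"
  shows "homotopy_extension_property TYPE('b) X A"
  unfolding homotopy_extension_property_def
proof (intro conjI allI impI A)
  fix Y :: "'b topology" and f H
  assume "continuous_map X Y f \<and>
    continuous_map (prod_topology (subtopology X A) (top_of_set {0..1::real})) Y H \<and>
    (\<forall>a\<in>A. H (a, 0) = f a)"
  then have f: "continuous_map X Y f"
    and H: "continuous_map (prod_topology (subtopology X A) (top_of_set {0..1::real})) Y H"
    and Hf: "\<And>a. a \<in> A \<Longrightarrow> H (a, 0) = f a" by auto
  let ?Q = "\<phi> ` A"
  let ?C = "M \<times> {0..1::real}"
  let ?T = "M \<times> {0} \<union> ?Q \<times> {0..1::real}"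
  obtain \<psi> where \<psi>: "homeomorphic_maps X (top_of_set M) \<phi> \<psi>"
    using hom homeomorphic_map_maps by blast
  then have c\<phi>: "continuous_map X (top_of_set M) \<phi>" and c\<psi>: "continuous_map (top_of_set M) X \<psi>"
    and \<psi>\<phi>: "\<And>x. x \<in> topspace X \<Longrightarrow> \<psi> (\<phi> x) = x"
    by (auto simp: homeomorphic_maps_def)
  have QM: "?Q \<subseteq> M" using c\<phi> A by (auto simp: continuous_map_def)
  obtain r where r: "retraction ?C ?T r"
    using compact_ANR_pair_retract[OF M(1) Q(1) QM M(2) Q(2)] unfolding retract_of_def by blast
  then have cr: "continuous_map (top_of_set ?C) (top_of_set ?T) r"
    and rid: "\<And>p. p \<in> ?T \<Longrightarrow> r p = p" by (auto simp: retraction_def Pi_iff)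
  \<comment> \<open>The two formulas overlap on \<open>?Q \<times> {0}\<close>, where they agree
    because \<open>H (a, 0) = f a\<close>; both pieces are closed, so \<open>g\<close> is continuous
    on \<open>?T\<close>.\<close>
  define g where "g p = (if snd p = 0 then f (\<psi> (fst p)) else H (\<psi> (fst p), snd p))" for p :: "'e \<times> real"
  have \<psi>A: "continuous_map (top_of_set ?Q) (subtopology X A) \<psi>"
  proof -
    have "continuous_map (top_of_set ?Q) X \<psi>"
      using continuous_map_from_subtopology[OF c\<psi>, of ?Q] QM
      by (simp add: subtopology_subtopology inf_absorb2)
    moreover have "\<psi> ` ?Q \<subseteq> A" using \<psi>\<phi> A by auto
    ultimately show ?thesis by (auto simp: continuous_map_in_subtopology)
  qed
  have fst0: "continuous_map (top_of_set (M \<times> {0::real})) (top_of_set M) fst"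
    by (auto intro: continuous_on_fst[OF continuous_on_id])
  have c1: "continuous_map (top_of_set (M \<times> {0::real})) Y (f \<circ> \<psi> \<circ> fst)"
    by (rule continuous_map_compose[OF fst0 continuous_map_compose[OF c\<psi> f]])
  have c2': "continuous_map (top_of_set (?Q \<times> {0..1::real}))
      (prod_topology (subtopology X A) (top_of_set {0..1})) (\<lambda>p. (\<psi> (fst p), snd p))"
  proof -
    have 1: "continuous_map (top_of_set (?Q \<times> {0..1::real})) (top_of_set ?Q) fst"
      and 2: "continuous_map (top_of_set (?Q \<times> {0..1::real})) (top_of_set {0..1}) snd"
      by (auto intro: continuous_intros)
    show ?thesis
      using continuous_map_compose[OF 1 \<psi>A] 2 by (simp add: continuous_map_paired o_def)
  qed
  have c2: "continuous_map (top_of_set (?Q \<times> {0..1::real})) Y (H \<circ> (\<lambda>p. (\<psi> (fst p), snd p)))"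
    by (rule continuous_map_compose[OF c2' H])
  have cg: "continuous_map (top_of_set ?T) Y g"
  proof (rule pasting_lemma_closed[where I = "UNIV :: bool set"
        and T = "\<lambda>b. if b then M \<times> {0} else ?Q \<times> {0..1}"
        and f = "\<lambda>b. if b then f \<circ> \<psi> \<circ> fst else H \<circ> (\<lambda>p. (\<psi> (fst p), snd p))"])
    show "closedin (top_of_set ?T) (if b then M \<times> {0} else ?Q \<times> {0..1})" for b
      using compact_imp_closed[OF M(1)] compact_imp_closed[OF Q(1)]
      by (auto intro!: closed_subset closed_Times)
    show "continuous_map (subtopology (top_of_set ?T) (if b then M \<times> {0} else ?Q \<times> {0..1})) Y
        (if b then f \<circ> \<psi> \<circ> fst else H \<circ> (\<lambda>p. (\<psi> (fst p), snd p)))" for b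
      using c1 c2 by (auto simp: subtopology_subtopology Int_absorb1)
    show "\<exists>b. b \<in> UNIV \<and> p \<in> (if b then M \<times> {0} else ?Q \<times> {0..1})
        \<and> g p = (if b then f \<circ> \<psi> \<circ> fst else H \<circ> (\<lambda>p. (\<psi> (fst p), snd p))) p"
      if "p \<in> topspace (top_of_set ?T)" for p
      using that QM by (intro exI[of _ "snd p = 0"]) (auto simp: g_def)
  qed (use \<psi>\<phi> subsetD[OF A] Hf in \<open>auto split: if_splits\<close>)
  have c\<phi>': "continuous_map (prod_topology X (top_of_set {0..1::real})) (top_of_set ?C)
      (\<lambda>p. (\<phi> (fst p), snd p))"
  proof -
    have C: "top_of_set ?C = prod_topology (top_of_set M) (top_of_set {0..1})"
      by (simp add: subtopology_Times flip: euclidean_product_topology)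
    have "continuous_map (prod_topology X (top_of_set {0..1::real})) (top_of_set M) (\<lambda>p. \<phi> (fst p))"
      using continuous_map_compose[OF continuous_map_fst c\<phi>] by (simp add: o_def)
    then show ?thesis
      unfolding C continuous_map_paired using continuous_map_snd by blast
  qed
  define K where "K = g \<circ> (r \<circ> (\<lambda>p. (\<phi> (fst p), snd p)))"
  have "continuous_map (prod_topology X (top_of_set {0..1::real})) Y K"
    unfolding K_def by (intro continuous_map_compose[OF _ cg] continuous_map_compose[OF c\<phi>' cr])
  moreover have "K (x, 0) = f x" if "x \<in> topspace X" for x
  proof -
    have "\<phi> x \<in> M" using that c\<phi> by (auto simp: continuous_map_def)
    then show ?thesis using that by (simp add: K_def rid g_def \<psi>\<phi>)
  qed
  moreover have "K (a, t) = H (a, t)" if "a \<in> A" "t \<in> {0..1}" for a t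
  proof -
    have "a \<in> topspace X" using that A by auto
    with that Hf show ?thesis by (simp add: K_def rid g_def \<psi>\<phi>)
  qed
  ultimately show "\<exists>K. continuous_map (prod_topology X (top_of_set {0..1::real})) Y K \<and>
      (\<forall>x\<in>topspace X. K (x, 0) = f x) \<and> (\<forall>a\<in>A. \<forall>t\<in>{0..1}. K (a, t) = H (a, t))"
    by blast
qed

section \<open>Involutive matrices in a convex set\<close>

lemma continuous_on_matrix_matrix_mult [continuous_intros]:
  fixes f :: "'s::topological_space \<Rightarrow> complex ^ 'm::finite ^ 'n::finite" and g :: "'s \<Rightarrow> complex ^ 'k::finite ^ 'm"
  shows "continuous_on S f \<Longrightarrow> continuous_on S g \<Longrightarrow> continuous_on S (\<lambda>x. f x ** g x)"
  unfolding matrix_matrix_mult_def by (intro continuous_intros)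

lemma bounded_bilinear_matrix_mult:
  "bounded_bilinear ((**) :: complex^'d^'d \<Rightarrow> complex^'d^'d \<Rightarrow> complex^'d::finite^'d)"
proof -
  have "bilinear ((**) :: complex^'d^'d \<Rightarrow> complex^'d^'d \<Rightarrow> complex^'d^'d)"
    unfolding bilinear_def
    by (intro conjI allI linearI)
      (simp_all add: vec_eq_iff matrix_matrix_mult_def sum.distrib scaleR_sum_right algebra_simps)
  then show ?thesis by (simp add: bilinear_conv_bounded_bilinear)
qed

text \<open>One Newton step for the matrix sign function: \<open>R \<mapsto> R (3 - R\<^sup>2) / 2\<close>.\<close>

definition newton :: "complex^'d::finite^'d \<Rightarrow> complex^'d^'d" where
  "newton R = R + (1/2) *\<^sub>R (R ** (mat 1 - R ** R))"

text \<open>\<open>newton R\<close> is \<open>R (1 + E/2)\<close>, all factors are polynomials in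
  \<open>R\<close>, and \<open>R ** R = mat 1 - E\<close>; so the new error is
  \<open>1 - (1 - E)(1 + E/2)^2\<close>, which has no term linear in \<open>E\<close>. This makes
  the convergence quadratic.\<close>

lemma newton_error:
  fixes R :: "complex^'d::finite^'d"
  defines "E \<equiv> mat 1 - R ** R"
  shows "mat 1 - newton R ** newton R = (3/4) *\<^sub>R (E ** E) + (1/4) *\<^sub>R (E ** E ** E)"
proof -
  interpret mm: bounded_bilinear "(**) :: complex^'d^'d \<Rightarrow> complex^'d^'d \<Rightarrow> complex^'d^'d"
    by (rule bounded_bilinear_matrix_mult)
  show ?thesis
    unfolding newton_def E_def
    by (simp only: mm.add_left mm.add_right mm.diff_left mm.diff_right mm.scaleR_left mm.scaleR_right
        matrix_mul_assoc scaleR_add_right scaleR_diff_right matrix_mul_lid matrix_mul_rid scaleR_scaleR,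
      simp only: vec_eq_iff vector_add_component vector_minus_component vector_scaleR_component,
      simp add: scaleR_conv_of_real field_simps)
qed

text \<open>Newton's iteration converges on \<open>U\<close>, a relatively open neighbourhood of the
  involutions in \<open>W\<close>. Its limit \<open>r\<close> is continuous, fixes involutions and
  stays in the closed invariant set \<open>W\<close>. A relatively open subset of a convex set is an
  ANR, and so is any retract of it.\<close>

lemma closed_ANR_involutions:
  fixes W :: "(complex^'d::finite^'d) set"
  assumes W: "closed W" "convex W" and newton: "\<And>R. R \<in> W \<Longrightarrow> newton R \<in> W"
  shows "ANR {R \<in> W. R ** R = mat 1}"
proof -
  interpret mm: bounded_bilinear "(**) :: complex^'d^'d \<Rightarrow> complex^'d^'d \<Rightarrow> complex^'d^'d"
    by (rule bounded_bilinear_matrix_mult)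
  \<comment> \<open>Scaling the norm by this \<open>K\<close> makes it submultiplicative, so the
    error is measured by \<open>K * norm (E R)\<close>.\<close>
  obtain K where K: "K > 0" "\<And>A B. norm ((A :: complex^'d^'d) ** (B :: complex^'d^'d)) \<le> norm A * norm B * K"
    using mm.pos_bounded by blast
  define E where "E R = mat 1 - R ** R" for R :: "complex^'d^'d"
  define U where "U = W \<inter> {R. K * norm (E R) < 1/2}"
  have err: "K * norm (E (newton R)) \<le> (K * norm (E R))\<^sup>2" if "K * norm (E R) \<le> 1" for R
  proof -
    let ?e = "norm (E R)"
    have 1: "norm (E R ** E R) \<le> ?e\<^sup>2 * K" using K(2)[of "E R" "E R"] by (simp add: power2_eq_square)
    have "norm (E R ** E R ** E R) \<le> norm (E R ** E R) * ?e * K" by (rule K(2))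
    also have "\<dots> \<le> (?e\<^sup>2 * K) * (?e * K)"
      using mult_right_mono[OF 1, of "?e * K"] K(1) by (simp add: mult.assoc)
    also have "\<dots> \<le> (?e\<^sup>2 * K) * 1"
      using that K(1) by (intro mult_left_mono) (auto simp: mult.commute)
    finally have 2: "norm (E R ** E R ** E R) \<le> ?e\<^sup>2 * K" by simp
    have "norm (E (newton R)) \<le> (3/4) * norm (E R ** E R) + (1/4) * norm (E R ** E R ** E R)"
      unfolding E_def newton_error by (rule norm_triangle_le) simp
    also have "\<dots> \<le> ?e\<^sup>2 * K" using 1 2 by simp
    finally have "K * norm (E (newton R)) \<le> K * (?e\<^sup>2 * K)"
      using K(1) by (intro mult_left_mono) auto
    then show ?thesis by (simp add: power2_eq_square mult_ac)
  qed
  \<comment> \<open>Starting below 1/2, squaring at least halves the error each time. The exponent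
    \<open>k + 1\<close> matches the bound in \<open>U\<close> at \<open>k = 0\<close>.\<close>
  have errk: "K * norm (E ((newton ^^ k) R)) \<le> (1/2) ^ (k + 1)" if "R \<in> U" for R k
  proof (induction k)
    case 0
    then show ?case using that by (simp add: U_def)
  next
    case (Suc k)
    have le: "(1/2::real) ^ (k + 1) \<le> 1/2" by (simp add: power_le_one)
    then have "K * norm (E (newton ((newton ^^ k) R))) \<le> (K * norm (E ((newton ^^ k) R)))\<^sup>2"
      using Suc by (intro err) linarith
    also have "\<dots> \<le> ((1/2) ^ (k + 1))\<^sup>2"
      using Suc K(1) by (intro power_mono) auto
    also have "\<dots> \<le> (1/2) ^ (k + 1) * (1/2)"
      unfolding power2_eq_square by (rule mult_left_mono[OF le]) simp
    finally show ?case by simp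
  qed
  have step: "norm (newton R - R) \<le> norm R * (K * norm (E R)) / 2" for R
    using K(2)[of R "E R"] by (simp add: newton_def E_def mult_ac)
  \<comment> \<open>The factor \<open>2 - (1/2)^k\<close> stays below 2 and closes the induction:
    with \<open>q = (1/2)^k\<close>, one step multiplies the bound by at most
    \<open>1 + q/4\<close>, and \<open>(2 - q)(1 + q/4) \<le> 2 - q/2\<close>.\<close>
  have bnd: "norm ((newton ^^ k) R) \<le> norm R * (2 - (1/2) ^ k)" if "R \<in> U" for R k
  proof (induction k)
    case (Suc k)
    let ?S = "(newton ^^ k) R" and ?q = "(1/2::real) ^ k"
    have "norm (newton ?S) \<le> norm ?S + norm (newton ?S - ?S)"
      using norm_triangle_ineq[of ?S "newton ?S - ?S"] by simp
    also have "\<dots> \<le> norm ?S * (1 + (K * norm (E ?S)) / 2)" using step[of ?S] by (simp add: algebra_simps)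
    also have "\<dots> \<le> (norm R * (2 - ?q)) * (1 + ?q / 4)"
      using Suc errk[OF that, of k] order.trans[OF norm_ge_zero Suc]
      by (intro mult_mono) (auto simp: K(1) less_imp_le)
    also have "\<dots> = norm R * ((2 - ?q) * (1 + ?q / 4))" by simp
    also have "\<dots> \<le> norm R * (2 - (1/2) ^ Suc k)"
    proof (rule mult_left_mono)
      have "(2 - ?q) * (1 + ?q / 4) = 2 - ?q / 2 - ?q\<^sup>2 / 4" by (simp add: field_simps power2_eq_square)
      then show "(2 - ?q) * (1 + ?q / 4) \<le> 2 - (1/2) ^ Suc k" by simp
    qed simp
    finally show ?case by simp
  qed simp
  have diff: "norm ((newton ^^ Suc k) R - (newton ^^ k) R) \<le> norm R * (1/2) ^ k" if "R \<in> U" for R k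
  proof -
    let ?S = "(newton ^^ k) R"
    have "norm (newton ?S - ?S) \<le> norm ?S * (K * norm (E ?S)) / 2" by (rule step)
    also have "\<dots> \<le> (norm R * 2) * (1/2) ^ (k + 1) / 2"
      using errk[OF that, of k] bnd[OF that, of k] K(1)
      by (intro divide_right_mono mult_mono order.trans[OF bnd[OF that, of k]] mult_left_mono) auto
    also have "\<dots> \<le> norm R * (1/2) ^ k" by (simp add: mult_left_mono)
    finally show ?thesis by simp
  qed
  \<comment> \<open>Writing the limit of the iterates as a telescoping series opens the way to the
    Weierstrass test for continuity.\<close>
  define r where "r R = R + (\<Sum>k. (newton ^^ Suc k) R - (newton ^^ k) R)" for R :: "complex^'d^'d"
  have tele: "(\<Sum>k<n. (newton ^^ Suc k) R - (newton ^^ k) R) = (newton ^^ n) R - R" for n and R :: "complex^'d^'d"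
    by (subst sum_lessThan_telescope) simp
  have lim: "(\<lambda>n. (newton ^^ n) R) \<longlonglongrightarrow> r R" if "R \<in> U" for R
  proof -
    have "summable (\<lambda>k. (newton ^^ Suc k) R - (newton ^^ k) R)"
      by (rule summable_comparison_test'[OF summable_mult[OF summable_geometric, of "1/2" "norm R"] diff[OF that]])
        simp
    then have "(\<lambda>n. R + ((newton ^^ n) R - R)) \<longlonglongrightarrow> r R"
      unfolding r_def tele[symmetric] by (intro tendsto_intros summable_LIMSEQ)
    then show ?thesis by simp
  qed
  have cnewton: "continuous_on UNIV (newton :: complex^'d^'d \<Rightarrow> _)"
    unfolding newton_def by (intro continuous_intros)
  have ck: "continuous_on UNIV (newton ^^ k :: complex^'d^'d \<Rightarrow> _)" for k
    by (induction k) (auto intro: continuous_on_compose2[OF cnewton] simp: o_def continuous_on_id)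
  have cE: "continuous_on UNIV E"
    unfolding E_def by (intro continuous_intros)
  have opU: "openin (top_of_set W) U"
    unfolding U_def by (intro openin_open_Int open_Collect_less continuous_intros cE)
  have cr: "continuous_on U r"
  proof -
    \<comment> \<open>The majorant \<open>norm R * (1/2)^k\<close> is uniform only on bounded sets;
      continuity is local, so balls suffice.\<close>
    have "continuous_on (U \<inter> ball 0 b) r" for b
    proof -
      have "uniform_limit (U \<inter> ball 0 b) (\<lambda>n R. \<Sum>k<n. (newton ^^ Suc k) R - (newton ^^ k) R)
          (\<lambda>R. \<Sum>k. (newton ^^ Suc k) R - (newton ^^ k) R) sequentially"
      proof (rule Weierstrass_m_test)
        show "summable (\<lambda>k. b * (1/2::real) ^ k)"
          by (intro summable_mult summable_geometric) simp
        show "norm ((newton ^^ Suc k) R - (newton ^^ k) R) \<le> b * (1/2) ^ k" if "R \<in> U \<inter> ball 0 b" for k R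
          using that by (intro order.trans[OF diff] mult_right_mono) auto
      qed
      then have "continuous_on (U \<inter> ball 0 b) (\<lambda>R. \<Sum>k. (newton ^^ Suc k) R - (newton ^^ k) R)"
        by (rule uniform_limit_theorem[rotated])
          (intro always_eventually allI continuous_on_sum continuous_on_diff continuous_on_subset[OF ck] subset_UNIV
            sequentially_bot)+
      then show ?thesis unfolding r_def by (intro continuous_intros)
    qed
    then have *: "(r \<longlongrightarrow> r x) (at x within U \<inter> ball 0 b)" if "x \<in> U \<inter> ball 0 b" for x b
      using that by (simp add: continuous_on_def)
    show ?thesis
      unfolding continuous_on_def
    proof
      fix x assume x: "x \<in> U"
      have "at x within U = at x within U \<inter> ball 0 (norm x + 1)"
        by (rule at_within_nhd[where S = "ball 0 (norm x + 1)"]) auto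
      then show "(r \<longlongrightarrow> r x) (at x within U)"
        using *[of x "norm x + 1"] x by simp
    qed
  qed
  have "retraction U {R \<in> W. R ** R = mat 1} r"
    unfolding retraction_def
  proof (intro conjI ballI)
    show "{R \<in> W. R ** R = mat 1} \<subseteq> U"
      using K(1) by (auto simp: U_def E_def)
    show "r \<in> U \<rightarrow> {R \<in> W. R ** R = mat 1}"
    proof
      fix R assume R: "R \<in> U"
      have inW: "(newton ^^ k) R \<in> W" for k
        using R by (induction k) (auto simp: U_def newton)
      have "r R \<in> W"
        using closed_sequentially[OF W(1) _ lim[OF R]] inW by blast
      moreover have "(\<lambda>k. E ((newton ^^ k) R)) \<longlonglongrightarrow> E (r R)"
        unfolding E_def by (intro tendsto_intros mm.tendsto lim R)
      moreover have "(\<lambda>k. E ((newton ^^ k) R)) \<longlonglongrightarrow> 0"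
      proof (rule Lim_null_comparison)
        show "\<forall>\<^sub>F k in sequentially. norm (E ((newton ^^ k) R)) \<le> (1/2) ^ (k + 1) / K"
          using errk[OF R] K(1) by (auto simp: field_simps)
        show "(\<lambda>k. (1/2) ^ (k + 1) / K) \<longlonglongrightarrow> 0"
          by (rule tendsto_eq_intros LIMSEQ_power_zero | use K(1) in simp)+
      qed
      ultimately show "r R \<in> {R \<in> W. R ** R = mat 1}"
        using LIMSEQ_unique[of "\<lambda>k. E ((newton ^^ k) R)" "E (r R)" 0] by (simp add: E_def)
    qed
    show "r R = R" if "R \<in> {R \<in> W. R ** R = mat 1}" for R
    proof -
      have "newton R = R" using that by (simp add: newton_def)
      then have "(newton ^^ k) R = R" for k by (induction k) auto
      then show ?thesis by (simp add: r_def del: funpow.simps)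
    qed
  qed (rule cr)
  then show ?thesis
    using ANR_retract_of_ANR ANR_openin[OF convex_imp_ANR[OF W(2)] opU]
    unfolding retract_of_def by blast
qed

section \<open>Lagrangian subspaces as involutions\<close>

definition herm :: "complex ^ 'd::finite \<Rightarrow> complex ^ 'd \<Rightarrow> complex" where
  "herm x y = (\<Sum>i\<in>UNIV. cnj (x $ i) * y $ i)"

lemma herm_simps:
  "herm (x + y) z = herm x z + herm y z" "herm x (y + z) = herm x y + herm x z"
  "herm (x - y) z = herm x z - herm y z" "herm x (y - z) = herm x y - herm x z"
  "herm (- x) y = - herm x y" "herm x (- y) = - herm x y"
  "herm (c *s x) y = cnj c * herm x y" "herm x (c *s y) = c * herm x y"
  "herm (r *\<^sub>R x) y = of_real r * herm x y" "herm x (r *\<^sub>R y) = of_real r * herm x y"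
  by (simp_all only: herm_def vector_scaleR_component)
    (simp_all add: sum.distrib sum_subtractf sum_negf sum_distrib_left scaleR_conv_of_real algebra_simps)

lemma scaleR_matrix_vector_mult:
  fixes A :: "complex ^ 'm::finite ^ 'n::finite"
  shows "(r *\<^sub>R A) *v x = r *\<^sub>R (A *v x)" "A *v (r *\<^sub>R x) = r *\<^sub>R (A *v x)"
  by (simp_all add: vec_eq_iff matrix_vector_mult_def scaleR_sum_right)

lemma herm_self: "herm x x = of_real ((norm x)\<^sup>2)"
  by (simp add: herm_def norm_vec_def L2_set_def sum_nonneg complex_norm_square mult.commute
      del: of_real_power)

lemma herm_self_eq_0_iff [simp]: "herm x x = 0 \<longleftrightarrow> x = 0"
  by (simp add: herm_self)

lemma continuous_on_herm [continuous_intros]: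
  "continuous_on S f \<Longrightarrow> continuous_on S g \<Longrightarrow> continuous_on S (\<lambda>x. herm (f x) (g x))"
  unfolding herm_def by (intro continuous_intros)

lemma continuous_on_matrix_vector_mult [continuous_intros]:
  fixes f :: "'s::topological_space \<Rightarrow> complex ^ 'm::finite ^ 'n::finite"
  shows "continuous_on S f \<Longrightarrow> continuous_on S g \<Longrightarrow> continuous_on S (\<lambda>x. f x *v g x)"
  unfolding matrix_vector_mult_def by (intro continuous_intros)

text \<open>The standard quaternionic structure. The sign sits on the \<open>Inl\<close> block so
  that pairing with \<open>tau x\<close> under \<open>herm\<close> gives
  \<open>omega x\<close>.\<close>

definition tau :: "complex ^ ('k::finite + 'k) \<Rightarrow> complex ^ ('k + 'k)" where
  "tau x = (\<chi> i. case i of Inl j \<Rightarrow> - cnj (x $ Inr j) | Inr j \<Rightarrow> cnj (x $ Inl j))"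

lemma tau_nth [simp]: "tau x $ Inl j = - cnj (x $ Inr j)" "tau x $ Inr j = cnj (x $ Inl j)"
  by (simp_all add: tau_def)

lemma vec_sum_eq_iff: "x = y \<longleftrightarrow> (\<forall>j. x $ Inl j = y $ Inl j) \<and> (\<forall>j. x $ Inr j = y $ Inr j)"
  for x y :: "'a ^ ('m::finite + 'n::finite)"
  unfolding vec_eq_iff by (metis sum.exhaust)

lemma tau_simps:
  "tau (x + y) = tau x + tau y" "tau (x - y) = tau x - tau y" "tau (- x) = - tau x"
  "tau (c *s x) = cnj c *s tau x" "tau (r *\<^sub>R x) = r *\<^sub>R tau x" "tau 0 = 0" "tau (tau x) = - x"
  by (simp_all add: vec_sum_eq_iff)

lemma tau_eq_0_iff [simp]: "tau x = 0 \<longleftrightarrow> x = 0"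
  by (metis tau_simps(6,7) neg_equal_0_iff_equal)

lemma continuous_on_tau [continuous_intros]:
  "continuous_on S f \<Longrightarrow> continuous_on S (\<lambda>x. tau (f x))"
  unfolding tau_def
  apply (rule continuous_on_vec_lambda)
  subgoal for i by (cases i) (auto intro!: continuous_intros)
  done

lemma sum_UNIV_sum: "(\<Sum>i\<in>UNIV. f i) = (\<Sum>j\<in>UNIV. f (Inl j)) + (\<Sum>j\<in>UNIV. f (Inr j))"
  for f :: "'m::finite + 'n::finite \<Rightarrow> 'a::comm_monoid_add"
  using sum.Plus[of "UNIV :: 'm set" "UNIV :: 'n set" f] by (simp add: UNIV_Plus_UNIV)

lemma omega_eq_herm_tau: "omega x y = herm (tau x) y"
  by (simp add: omega_def herm_def sum_UNIV_sum sum_subtractf sum_negf)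

lemma herm_commute: "herm y x = cnj (herm x y)"
  by (simp add: herm_def mult.commute)

lemma tau_image_subspace:
  assumes "vec.subspace S" shows "vec.subspace (tau ` S)"
  unfolding vec.subspace_def
proof (intro conjI ballI allI)
  show "0 \<in> tau ` S" using vec.subspace_0[OF assms] by (force simp: tau_simps intro: image_eqI[of _ _ 0])
  show "x + y \<in> tau ` S" if "x \<in> tau ` S" "y \<in> tau ` S" for x y
    using that by (auto simp: tau_simps(1)[symmetric] intro!: imageI vec.subspace_add[OF assms])
  show "c *s x \<in> tau ` S" if x: "x \<in> tau ` S" for c x
  proof -
    obtain z where "z \<in> S" "x = tau z" using x by blast
    then have "c *s x = tau (cnj c *s z)" by (simp add: tau_simps)
    then show ?thesis using vec.subspace_scale[OF assms \<open>z \<in> S\<close>] by blast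
  qed
qed

lemma tau_tau_image:
  assumes "vec.subspace S" shows "tau ` tau ` S = S"
proof -
  have "tau ` tau ` S = uminus ` S" by (simp add: image_image tau_simps)
  also have "\<dots> = S" using vec.subspace_neg[OF assms] by (force intro: image_eqI[of _ _ "- _"])
  finally show ?thesis .
qed

text \<open>As \<open>tau\<close> is antilinear, the bound is derived from bases: the image of a
  basis of \<open>T\<close> spans the image of \<open>T\<close>. Applying the bound to
  \<open>S\<close> and to its image, with \<open>tau_tau_image\<close>, gives equality.\<close>

lemma dim_tau_image:
  assumes "vec.subspace S" shows "vec.dim (tau ` S) = vec.dim S"
proof -
  have le: "vec.dim (tau ` T) \<le> vec.dim T" if T: "vec.subspace T" for T :: "(complex ^ ('k::finite + 'k)) set"
  proof -
    obtain B where B: "B \<subseteq> T" "vec.independent B" "T \<subseteq> vec.span B" "card B = vec.dim T"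
      using vec.basis_exists by metis
    have "finite B" using B(2) by (rule vec.finiteI_independent)
    have "vec.subspace (tau ` vec.span (tau ` B))" by (intro tau_image_subspace vec.subspace_span)
    \<comment> \<open>Each \<open>b\<close> equals \<open>tau (- tau b)\<close>, since
      \<open>tau\<close> squares to -1.\<close>
    moreover have "B \<subseteq> tau ` vec.span (tau ` B)"
    proof
      fix b assume "b \<in> B"
      then have "- tau b \<in> vec.span (tau ` B)" by (intro vec.span_neg vec.span_base) auto
      then show "b \<in> tau ` vec.span (tau ` B)" by (force simp: tau_simps intro: image_eqI[of _ _ "- tau b"])
    qed
    ultimately have "vec.span B \<subseteq> tau ` vec.span (tau ` B)" by (rule vec.span_minimal[rotated])
    then have "tau ` T \<subseteq> tau ` tau ` vec.span (tau ` B)" using B(3) by blast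
    then have "tau ` T \<subseteq> vec.span (tau ` B)" by (simp add: tau_tau_image vec.subspace_span)
    then have "vec.dim (tau ` T) \<le> card (tau ` B)"
      using \<open>finite B\<close> by (intro vec.dim_le_card) auto
    then show ?thesis using card_image_le[OF \<open>finite B\<close>, of tau] B(4) by simp
  qed
  show ?thesis
    using le[OF assms] le[OF tau_image_subspace[OF assms]] tau_tau_image[OF assms] by simp
qed

section \<open>Involutions and their fixed Lagrangians\<close>

text \<open>Both conditions are real-linear in \<open>R\<close> and neither is complex-linear, so
  this is a real vector space of matrices. The quadratic condition is added separately in
  \<open>lag_involutions\<close>.\<close>

definition involution_space :: "(complex ^ ('k::finite + 'k) ^ ('k + 'k)) set" where
  "involution_space = {R. (\<forall>x y. herm (R *v x) y = herm x (R *v y)) \<and> (\<forall>x. R *v tau x = - tau (R *v x))}"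

definition lag_involutions :: "(complex ^ ('k::finite + 'k) ^ ('k + 'k)) set" where
  "lag_involutions = {R \<in> involution_space. R ** R = mat 1}"

definition fixed_space :: "complex ^ 'd::finite ^ 'd \<Rightarrow> (complex ^ 'd) set" where
  "fixed_space R = {x. R *v x = x}"

lemma lag_involutionsD:
  assumes "R \<in> lag_involutions"
  shows "herm (R *v x) y = herm x (R *v y)" "R *v tau x = - tau (R *v x)" "R *v (R *v x) = x"
  using assms by (auto simp: lag_involutions_def involution_space_def matrix_vector_mul_assoc)

lemma subspace_fixed_space: "vec.subspace (fixed_space R)"
  by (auto simp: fixed_space_def vec.subspace_def matrix_vector_right_distrib vec.scale
      intro: matrix_vector_mul_linear_gen[THEN vec.linear_scale, THEN trans])

text \<open>If \<open>x\<close> and \<open>tau x\<close> both lie in \<open>L\<close>, isotropy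
  makes \<open>omega x (tau x)\<close>, the squared norm of \<open>tau x\<close>, vanish.\<close>

lemma isotropic_Int_tau:
  assumes "\<And>x y. x \<in> L \<Longrightarrow> y \<in> L \<Longrightarrow> omega x y = 0"
  shows "L \<inter> tau ` L \<subseteq> {0}"
proof clarsimp
  fix x assume "x \<in> L" "tau x \<in> L"
  then have "herm (tau x) (tau x) = 0" using assms[of x "tau x"] by (simp add: omega_eq_herm_tau)
  then show "x = 0" by simp
qed

text \<open>Anticommutation puts the \<open>tau\<close> image of the fixed space into the -1
  eigenspace, which is orthogonal to the fixed space because \<open>R\<close> is self-adjoint; this
  is isotropy. The eigenspace projections \<open>(x + R x)/2\<close> and \<open>(x - R x)/2\<close>
  show that the fixed space and its \<open>tau\<close> image span everything. Their dimensions
  agree, so each is half of the total.\<close>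

lemma fixed_space_lagrangian:
  fixes R :: "complex ^ ('k::finite + 'k) ^ ('k + 'k)"
  assumes R: "R \<in> lag_involutions"
  shows "fixed_space R \<in> lagrangians"
proof -
  let ?L = "fixed_space R"
  note sub = subspace_fixed_space[of R]
  have iso: "omega x y = 0" if "x \<in> ?L" "y \<in> ?L" for x y
  proof -
    have "herm (tau x) y = herm (R *v tau x) y"
      using that lag_involutionsD(1)[OF R, of "tau x" y] by (simp add: fixed_space_def)
    also have "\<dots> = - herm (tau x) y"
      using that by (simp add: lag_involutionsD(2)[OF R] fixed_space_def herm_simps)
    finally show ?thesis by (simp add: omega_eq_herm_tau)
  qed
  have "{x + y | x y. x \<in> ?L \<and> y \<in> tau ` ?L} = UNIV"
  proof -
    have "\<exists>a b. x = a + b \<and> a \<in> ?L \<and> b \<in> tau ` ?L" for x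
    proof (intro exI conjI)
      let ?a = "(1/2) *\<^sub>R (x + R *v x)" and ?b = "(1/2) *\<^sub>R (x - R *v x)"
      show "x = ?a + ?b" by (simp add: scaleR_add_right[symmetric] del: scaleR_add_right)
      show "?a \<in> ?L"
        by (simp add: fixed_space_def scaleR_matrix_vector_mult matrix_vector_right_distrib
            lag_involutionsD(3)[OF R] add.commute)
      \<comment> \<open>From \<open>R ?b = - ?b\<close> and anticommutation, \<open>tau ?b\<close>
        is fixed, so \<open>?b\<close> lies in the \<open>tau\<close> image of the fixed
        space.\<close>
      have "?b = tau (- tau ?b)" by (simp only: tau_simps(3,7) minus_minus)
      moreover have "- tau ?b \<in> ?L"
        by (simp add: fixed_space_def scaleR_matrix_vector_mult matrix_vector_mult_diff_distrib
            lag_involutionsD(2,3)[OF R] tau_simps algebra_simps vec.neg)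
      ultimately show "?b \<in> tau ` ?L" by blast
    qed
    then show ?thesis by blast
  qed
  moreover have "?L \<inter> tau ` ?L = {0}"
    using isotropic_Int_tau[of ?L] iso vec.subspace_0[OF sub] vec.subspace_0[OF tau_image_subspace[OF sub]]
    by blast
  ultimately have "vec.dim (UNIV :: (complex ^ ('k + 'k)) set) = vec.dim ?L + vec.dim ?L"
    using vec.dim_sums_Int[OF sub tau_image_subspace[OF sub]] by (simp add: dim_tau_image[OF sub])
  then have "vec.dim ?L = CARD('k)"
    by (simp add: vec.dim_UNIV card_cart_basis)
  then show ?thesis using sub iso by (simp add: lagrangians_def)
qed

text \<open>\<open>L\<close> and its \<open>tau\<close> image meet only in 0 and have dimension
  \<open>CARD('k)\<close> each, so their sum is the whole space.\<close>

lemma lagrangian_decomp: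
  fixes L :: "(complex ^ ('k::finite + 'k)) set"
  assumes "L \<in> lagrangians"
  shows "\<exists>u\<in>L. x - u \<in> tau ` L"
proof -
  have sub: "vec.subspace L" and dim: "vec.dim L = CARD('k)" and iso: "\<And>x y. x \<in> L \<Longrightarrow> y \<in> L \<Longrightarrow> omega x y = 0"
    using assms by (auto simp: lagrangians_def)
  note subt = tau_image_subspace[OF sub]
  let ?S = "{x + y | x y. x \<in> L \<and> y \<in> tau ` L}"
  have "L \<inter> tau ` L = {0}"
    using isotropic_Int_tau[of L] iso vec.subspace_0[OF sub] vec.subspace_0[OF subt] by blast
  then have "vec.dim ?S = CARD('k + 'k)"
    using vec.dim_sums_Int[OF sub subt] by (simp add: dim_tau_image[OF sub] dim)
  then have "?S = UNIV"
    using vec.subspace_dim_equal[OF vec.subspace_sums[OF sub subt] vec.subspace_UNIV]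
    by (simp add: vec.dim_UNIV card_cart_basis)
  then obtain u v where "x = u + v" "u \<in> L" "v \<in> tau ` L" by blast
  then show ?thesis by (intro bexI[of _ u]) auto
qed

text \<open>With \<open>u\<close> the projection onto \<open>L\<close> along its \<open>tau\<close>
  image, the reflection \<open>2 u - 1\<close> is the wanted involution.\<close>

lemma lag_involution_exists:
  fixes L :: "(complex ^ ('k::finite + 'k)) set"
  assumes L: "L \<in> lagrangians"
  shows "\<exists>R \<in> lag_involutions. fixed_space R = L"
proof -
  have sub: "vec.subspace L" and dim: "vec.dim L = CARD('k)" and iso: "\<And>x y. x \<in> L \<Longrightarrow> y \<in> L \<Longrightarrow> omega x y = 0"
    using L by (auto simp: lagrangians_def)
  note subt = tau_image_subspace[OF sub]
  obtain u where u: "\<And>x. u x \<in> L" "\<And>x. x - u x \<in> tau ` L"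
    using lagrangian_decomp[OF L] by metis
  \<comment> \<open>Uniqueness of the splitting computes \<open>u\<close> from any decomposition; in
    particular it makes the chosen \<open>u\<close> linear.\<close>
  have uniq: "u x = a" if "a \<in> L" "x - a \<in> tau ` L" for x a
  proof -
    have "u x - a \<in> L" using u that sub by (simp add: vec.subspace_diff)
    moreover have "(x - a) - (x - u x) \<in> tau ` L"
      using vec.subspace_diff[OF subt that(2) u(2)] .
    ultimately have "u x - a \<in> L \<inter> tau ` L" by simp
    then show ?thesis using isotropic_Int_tau[of L] iso by fastforce
  qed
  have lin: "Vector_Spaces.linear (*s) (*s) (\<lambda>x. 2 *s u x - x)"
  proof (rule Vector_Spaces.linear_iff[THEN iffD2], intro conjI allI vec.vector_space_axioms)
    fix x y c
    have "u (x + y) = u x + u y"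
      using vec.subspace_add[OF subt u(2) u(2), of x y]
      by (intro uniq vec.subspace_add[OF sub] u) (simp add: algebra_simps)
    then show "2 *s u (x + y) - (x + y) = (2 *s u x - x) + (2 *s u y - y)" by (simp add: vec.scale_right_distrib)
    have "u (c *s x) = c *s u x"
      using vec.subspace_scale[OF subt u(2), of c x]
      by (intro uniq vec.subspace_scale[OF sub] u) (simp add: vec.scale_right_diff_distrib)
    then show "2 *s u (c *s x) - c *s x = c *s (2 *s u x - x)"
      by (simp add: vec.scale_right_diff_distrib mult.commute)
  qed
  define R where "R = matrix (\<lambda>x. 2 *s u x - x)"
  have R: "R *v x = 2 *s u x - x" for x
    unfolding R_def by (rule matrix_works[OF lin])
  have RL: "R *v x = x" if "x \<in> L" for x
    using uniq[OF that, of x] vec.subspace_0[OF subt] by (simp add: R vec_eq_iff)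
  have RtL: "R *v y = - y" if "y \<in> tau ` L" for y
    using uniq[OF vec.subspace_0[OF sub], of y] that by (simp add: R)
  have dec: "\<exists>a b. x = a + tau b \<and> a \<in> L \<and> b \<in> L" for x
    using u[of x] by (metis add_diff_cancel_left' diff_add_cancel imageE add.commute)
  \<comment> \<open>Since \<open>omega b a = herm (tau b) a\<close>, isotropy of \<open>L\<close>
    says that the splitting is orthogonal, which yields self-adjointness.\<close>
  have orth: "herm (tau b) a = 0" "herm a (tau b) = 0" if "a \<in> L" "b \<in> L" for a b
    using iso[of b a] that by (simp_all add: omega_eq_herm_tau) (simp add: herm_commute[of a])
  have RR: "R *v (a + tau b) = a - tau b" if "a \<in> L" "b \<in> L" for a b
    using that by (simp add: matrix_vector_right_distrib RL RtL)
  have "herm (R *v x) y = herm x (R *v y)" for x y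
  proof -
    obtain a b a' b' where "x = a + tau b" "a \<in> L" "b \<in> L" "y = a' + tau b'" "a' \<in> L" "b' \<in> L"
      using dec[of x] dec[of y] by blast
    then show ?thesis by (simp add: RR herm_simps orth)
  qed
  moreover have "R *v tau x = - tau (R *v x)" for x
  proof -
    obtain a b where x: "x = a + tau b" "a \<in> L" "b \<in> L" using dec by blast
    then have "tau x = (- b) + tau a" by (simp add: tau_simps)
    then show ?thesis using x vec.subspace_neg[OF sub] RR[of "- b" a] by (simp add: RR tau_simps)
  qed
  moreover have "R ** R = mat 1"
    unfolding matrix_eq
  proof
    fix x
    obtain a b where x: "x = a + tau b" "a \<in> L" "b \<in> L" using dec by blast
    then have "R *v (R *v x) = R *v (a + tau (- b))" by (simp add: RR tau_simps)
    also have "\<dots> = x" using x vec.subspace_neg[OF sub] by (subst RR) (auto simp: tau_simps)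
    finally show "R ** R *v x = mat 1 *v x" by (simp add: matrix_vector_mul_assoc)
  qed
  ultimately have RI: "R \<in> lag_involutions" by (simp add: lag_involutions_def involution_space_def)
  have "L \<subseteq> fixed_space R" using RL by (auto simp: fixed_space_def)
  then have "L = fixed_space R"
    using fixed_space_lagrangian[OF RI] dim
    by (intro vec.subspace_dim_equal sub) (auto simp: lagrangians_def)
  then show ?thesis using RI by blast
qed

text \<open>Anticommutation determines both matrices on the \<open>tau\<close> image of
  \<open>fixed_space S\<close>, which together with \<open>fixed_space S\<close> spans everything.
  The inclusion is the form in which a frame condition \<open>R ** A = A\<close> delivers the
  hypothesis.\<close>

lemma lag_involution_unique:
  assumes R: "R \<in> lag_involutions" and S: "S \<in> lag_involutions" and sub: "fixed_space S \<subseteq> fixed_space R"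
  shows "R = S"
  unfolding matrix_eq
proof
  fix x
  obtain u where u: "u \<in> fixed_space S" "x - u \<in> tau ` fixed_space S"
    using lagrangian_decomp[OF fixed_space_lagrangian[OF S]] by blast
  then obtain v where v: "x - u = tau v" "v \<in> fixed_space S" by blast
  then have x: "x = u + tau v" by (simp add: algebra_simps)
  have "R *v u = u" "R *v v = v" "S *v u = u" "S *v v = v"
    using u v sub by (auto simp: fixed_space_def)
  then show "R *v x = S *v x"
    by (simp add: x matrix_vector_right_distrib lag_involutionsD(2)[OF R] lag_involutionsD(2)[OF S])
qed

lemma bij_betw_fixed_space: "bij_betw fixed_space lag_involutions lagrangians"
  unfolding bij_betw_def inj_on_def
  using fixed_space_lagrangian lag_involution_exists lag_involution_unique by blast

section \<open>Topology of the involutions and the homeomorphism with Lagrangians\<close>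

lemma closed_involution_space: "closed involution_space"
  unfolding involution_space_def Collect_conj_eq
  by (intro closed_Int closed_Collect_all closed_Collect_eq continuous_intros)

lemma convex_involution_space: "convex involution_space"
  by (auto simp: convex_def involution_space_def matrix_vector_mult_add_rdistrib herm_simps
      tau_simps scaleR_matrix_vector_mult)

text \<open>A self-adjoint involution is unitary, so its columns are unit vectors and its entries
  are bounded by 1; the defining equations are closed.\<close>

lemma compact_lag_involutions: "compact lag_involutions"
proof -
  have "norm (R $ i $ j) \<le> 1" if R: "R \<in> lag_involutions" for R :: "complex ^ ('k::finite + 'k) ^ ('k + 'k)" and i j
  proof -
    let ?x = "R *v axis j 1"
    have "herm ?x ?x = herm (axis j 1) (axis j 1)" by (simp add: lag_involutionsD[OF R])
    then have "norm ?x = 1" by (simp add: herm_self power2_eq_1_iff del: of_real_power)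
        (metis norm_ge_zero neg_0_le_iff_le not_one_le_zero)
    moreover have "?x $ i = R $ i $ j"
      by (simp add: matrix_vector_mult_def axis_def if_distrib cong: if_cong)
    ultimately show ?thesis using Finite_Cartesian_Product.norm_nth_le[of ?x i] by simp
  qed
  then have row: "norm (R $ i) \<le> (\<Sum>j\<in>(UNIV :: ('k + 'k) set). 1)"
    if "R \<in> lag_involutions" for R :: "complex ^ ('k::finite + 'k) ^ ('k + 'k)" and i
    unfolding norm_vec_def[of "R $ i"] using that by (intro order.trans[OF L2_set_le_sum] sum_mono) auto
  have "norm R \<le> (\<Sum>i\<in>(UNIV :: ('k + 'k) set). \<Sum>j\<in>(UNIV :: ('k + 'k) set). 1)"
    if "R \<in> lag_involutions" for R :: "complex ^ ('k::finite + 'k) ^ ('k + 'k)"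
    unfolding norm_vec_def[of R] using row[OF that] by (intro order.trans[OF L2_set_le_sum] sum_mono) auto
  then have "bounded lag_involutions" unfolding bounded_iff by blast
  moreover have "closed lag_involutions"
    unfolding lag_involutions_def Collect_conj_eq Collect_mem_eq
    by (intro closed_Int closed_involution_space closed_Collect_eq continuous_intros)
  ultimately show ?thesis by (simp add: compact_eq_bounded_closed)
qed

text \<open>Continuity is local, and near each \<open>R\<close> the map lifts continuously to
  \<open>frames\<close>, from which the quotient map leads to the Grassmannian.\<close>

lemma continuous_map_fixed_space:
  "continuous_map (top_of_set lag_involutions)
     (lagrangian_topology :: (complex ^ ('k::finite + 'k)) set topology) fixed_space"
proof -
  let ?Gr = "grassmannian_topology TYPE('k) :: (complex ^ ('k + 'k)) set topology"
  let ?q = "\<lambda>A :: complex ^ 'k ^ ('k + 'k). range ((*v) A)"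
  let ?I = "lag_involutions :: (complex ^ ('k + 'k) ^ ('k + 'k)) set"
  have sub: "vec.subspace (fixed_space R)" "vec.dim (fixed_space R) = CARD('k)" if "R \<in> ?I" for R
    using fixed_space_lagrangian[OF that] by (auto simp: lagrangians_def)
  have "\<exists>T. R \<in> T \<and> openin (top_of_set ?I) T \<and> continuous_map (subtopology (top_of_set ?I) T) ?Gr fixed_space"
    if R: "R \<in> ?I" for R
  proof -
    have "fixed_space R \<in> topspace ?Gr"
      using sub[OF R] by (simp add: topspace_grassmannian_topology)
    then obtain A :: "complex ^ 'k ^ ('k + 'k)" where A: "A \<in> frames" "range ((*v) A) = fixed_space R"
      by (auto simp: grassmannian_topology_def topspace_quotient_topology)
    obtain B where B: "B ** A = mat 1"
      using A(1) by (auto simp: frames_def simp flip: matrix_left_invertible_injective)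
    \<comment> \<open>A frame at \<open>R\<close>, projected to the fixed spaces of nearby involutions, is a local section.\<close>
    define F where "F S = (1/2) *\<^sub>R ((mat 1 + S) ** A)" for S :: "complex ^ ('k + 'k) ^ ('k + 'k)"
    have F: "F S *v x = (1/2) *\<^sub>R (A *v x + S *v (A *v x))" for S x
      by (simp add: F_def scaleR_matrix_vector_mult matrix_vector_mult_add_rdistrib
          flip: matrix_vector_mul_assoc)
    \<comment> \<open>\<open>B\<close> is a left inverse of \<open>A\<close>. Nonvanishing of this
      determinant is an open condition, it makes \<open>F S\<close> injective, and it holds at
      \<open>R\<close> because \<open>F R = A\<close>.\<close>
    define T where "T = {S \<in> ?I. det (B ** F S) \<noteq> 0}"
    have cF: "continuous_on UNIV F" unfolding F_def by (intro continuous_intros)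
    have "continuous_on UNIV (\<lambda>S. det (B ** F S))"
      unfolding det_def matrix_matrix_mult_def
      by (intro continuous_intros cF)
    then have "openin (top_of_set ?I) (?I \<inter> {S. det (B ** F S) \<noteq> 0})"
      by (intro openin_open_Int open_Collect_neq continuous_intros)
    then have op: "openin (top_of_set ?I) T" by (simp add: T_def Collect_conj_eq)
    have frame: "F S \<in> frames" "range ((*v) (F S)) = fixed_space S" if S: "S \<in> T" for S
    proof -
      have SI: "S \<in> ?I" and "det (B ** F S) \<noteq> 0" using S by (auto simp: T_def)
      then obtain C where "C ** (B ** F S) = mat 1"
        by (metis invertible_det_nz invertible_def)
      then have "(C ** B) ** F S = mat 1" by (simp add: matrix_mul_assoc)
      then show fr: "F S \<in> frames"
        unfolding frames_def using matrix_left_invertible_injective[of "F S"] by auto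
      have "range ((*v) (F S)) \<subseteq> fixed_space S"
        by (auto simp: fixed_space_def F scaleR_matrix_vector_mult matrix_vector_right_distrib
            lag_involutionsD(3)[OF SI] add.commute)
      moreover have "range ((*v) (F S)) \<in> topspace ?Gr"
        using fr by (auto simp: grassmannian_topology_def topspace_quotient_topology)
      ultimately show "range ((*v) (F S)) = fixed_space S"
        using sub[OF SI] by (intro vec.subspace_dim_equal) (auto simp: topspace_grassmannian_topology)
    qed
    have "F R = A"
      unfolding matrix_eq
    proof
      fix x
      have "R *v (A *v x) = A *v x" using A(2) by (auto simp: fixed_space_def)
      then show "F R *v x = A *v x" by (simp add: F scaleR_2[symmetric])
    qed
    then have "R \<in> T" using R B by (simp add: T_def)
    moreover have "continuous_map (top_of_set T) ?Gr (?q \<circ> F)"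
    proof (rule continuous_map_compose)
      show "continuous_map (top_of_set T) (top_of_set frames) F"
        using frame continuous_on_subset[OF cF] by auto
      show "continuous_map (top_of_set frames) ?Gr ?q"
        unfolding grassmannian_topology_def
        by (rule quotient_imp_continuous_map[OF quotient_map_quotient_topology])
    qed
    then have "continuous_map (top_of_set T) ?Gr fixed_space"
      by (rule continuous_map_eq) (simp add: frame)
    moreover have "subtopology (top_of_set ?I) T = top_of_set T"
      by (simp add: subtopology_subtopology T_def Int_absorb1)
    ultimately show ?thesis using op by auto
  qed
  then obtain T where T: "\<And>R. R \<in> ?I \<Longrightarrow> R \<in> T R" "\<And>R. R \<in> ?I \<Longrightarrow> openin (top_of_set ?I) (T R)"
      "\<And>R. R \<in> ?I \<Longrightarrow> continuous_map (subtopology (top_of_set ?I) (T R)) ?Gr fixed_space"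
    by metis
  have "continuous_map (top_of_set ?I) ?Gr fixed_space"
    by (rule pasting_lemma[where I = ?I and T = T and f = "\<lambda>_. fixed_space"]) (use T in auto)
  then show ?thesis
    using fixed_space_lagrangian unfolding lagrangian_topology_def
    by (auto simp: continuous_map_in_subtopology)
qed

definition lag_involution :: "(complex ^ ('k::finite + 'k)) set \<Rightarrow> complex ^ ('k + 'k) ^ ('k + 'k)" where
  "lag_involution = inv_into lag_involutions fixed_space"

lemma lag_involution:
  assumes "L \<in> lagrangians"
  shows "lag_involution L \<in> lag_involutions" "fixed_space (lag_involution L) = L"
  using assms bij_betw_fixed_space unfolding lag_involution_def bij_betw_def
  by (metis inv_into_into, metis f_inv_into_f)

lemma lag_involution_fixed_space:
  "R \<in> lag_involutions \<Longrightarrow> lag_involution (fixed_space R) = R"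
  unfolding lag_involution_def by (rule bij_betw_inv_into_left[OF bij_betw_fixed_space])

text \<open>The Lagrangians form a closed subset of the Grassmannian, so the column span restricts
  to a quotient map on Lagrangian frames, and continuity can be checked on those frames.\<close>

lemma continuous_map_lag_involution:
  "continuous_map (lagrangian_topology :: (complex ^ ('k::finite + 'k)) set topology)
     (top_of_set lag_involutions) lag_involution"
proof -
  let ?Gr = "grassmannian_topology TYPE('k) :: (complex ^ ('k + 'k)) set topology"
  let ?q = "\<lambda>A :: complex ^ 'k ^ ('k + 'k). range ((*v) A)"
  let ?I = "lag_involutions :: (complex ^ ('k + 'k) ^ ('k + 'k)) set"
  define F where "F = {A :: complex ^ 'k ^ ('k + 'k). A \<in> frames \<and> ?q A \<in> lagrangians}"
  have q: "quotient_map (top_of_set frames) ?Gr ?q"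
    unfolding grassmannian_topology_def by (rule quotient_map_quotient_topology)
  have Gr: "?q A \<in> topspace ?Gr" if "A \<in> frames" for A
    using that by (auto simp: grassmannian_topology_def topspace_quotient_topology)
  \<comment> \<open>The column span of a frame always has the right dimension, so only isotropy
    remains, and that is a closed condition.\<close>
  have F: "F = frames \<inter> {A. \<forall>x y. omega (A *v x) (A *v y) = 0}"
    using Gr by (auto simp: F_def lagrangians_def topspace_grassmannian_topology)
  have "closed {A :: complex ^ 'k ^ ('k + 'k). \<forall>x y. omega (A *v x) (A *v y) = 0}"
    unfolding omega_eq_herm_tau by (intro closed_Collect_all closed_Collect_eq continuous_intros)
  then have "closedin (top_of_set frames) F"
    unfolding F by (rule closedin_closed_Int)
  moreover have "{A \<in> topspace (top_of_set frames). ?q A \<in> lagrangians} = F" by (auto simp: F_def)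
  moreover have sub: "lagrangians \<subseteq> topspace ?Gr"
    by (auto simp: topspace_grassmannian_topology lagrangians_def)
  ultimately have "closedin ?Gr lagrangians"
    using q[unfolded quotient_map_closedin, THEN conjunct2, rule_format, OF sub] by simp
  then have "quotient_map (subtopology (top_of_set frames) F) (subtopology ?Gr lagrangians) ?q"
    by (intro quotient_map_restriction[OF q]) (auto simp: F_def)
  moreover have "subtopology (top_of_set frames) F = top_of_set F"
    by (simp add: subtopology_subtopology F_def Int_absorb1 Collect_mono_iff subset_iff)
  ultimately have qF: "quotient_map (top_of_set F) lagrangian_topology ?q"
    by (simp add: lagrangian_topology_def)
  \<comment> \<open>The involution of a Lagrangian frame is singled out by a closed condition, and involutions form a
    compact set, so its graph being closed already gives continuity.\<close>
  have graph: "lag_involution (?q A) = R \<longleftrightarrow> R ** A = A" if A: "A \<in> F" and R: "R \<in> ?I" for A R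
  proof
    have L: "?q A \<in> lagrangians" using A by (simp add: F_def)
    show "R ** A = A" if "lag_involution (?q A) = R"
      using lag_involution(2)[OF L] that
      by (auto simp: matrix_eq fixed_space_def simp flip: matrix_vector_mul_assoc)
    assume "R ** A = A"
    then have "R *v (A *v x) = A *v x" for x by (simp add: matrix_vector_mul_assoc)
    then have "?q A \<subseteq> fixed_space R" by (auto simp: fixed_space_def)
    then show "lag_involution (?q A) = R"
      using lag_involution_unique[OF R lag_involution(1)[OF L]] lag_involution(2)[OF L] by simp
  qed
  have into: "lag_involution (?q A) \<in> ?I" if "A \<in> F" for A
    using lag_involution(1) that by (auto simp: F_def)
  have "(\<lambda>A. (A, lag_involution (?q A))) ` F = (F \<times> ?I) \<inter> {p. snd p ** fst p = fst p}"
    using graph into by force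
  moreover have "closed {p :: (complex ^ 'k ^ ('k + 'k)) \<times> (complex ^ ('k + 'k) ^ ('k + 'k)). snd p ** fst p = fst p}"
    by (intro closed_Collect_eq continuous_intros)
  ultimately have "continuous_on F (\<lambda>A. lag_involution (?q A))"
    using into
    by (subst continuous_closed_graph_eq[OF compact_lag_involutions])
      (auto intro: closedin_closed_Int)
  then have "continuous_map (top_of_set F) (top_of_set ?I) (lag_involution \<circ> ?q)"
    using into by (auto simp: o_def)
  then show ?thesis by (rule continuous_compose_quotient_map[OF qF])
qed

lemma homeomorphic_map_lag_involution:
  "homeomorphic_map lagrangian_topology (top_of_set lag_involutions) lag_involution"
  unfolding homeomorphic_map_maps homeomorphic_maps_def
  using continuous_map_lag_involution continuous_map_fixed_space lag_involution_fixed_space lag_involution(2)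
  by (intro exI[of _ fixed_space]) (auto simp: topspace_lagrangian_topology)

section \<open>Embedded real Lagrangian subspaces\<close>

definition vcnj :: "complex ^ 'd::finite \<Rightarrow> complex ^ 'd" where
  "vcnj x = (\<chi> i. cnj (x $ i))"

definition re_vec :: "complex ^ 'd::finite \<Rightarrow> real ^ 'd" where
  "re_vec x = (\<chi> i. Re (x $ i))"

definition im_vec :: "complex ^ 'd::finite \<Rightarrow> real ^ 'd" where
  "im_vec x = (\<chi> i. Im (x $ i))"

lemma vcnj_nth [simp]: "vcnj x $ i = cnj (x $ i)"
  and re_vec_nth [simp]: "re_vec x $ i = Re (x $ i)"
  and im_vec_nth [simp]: "im_vec x $ i = Im (x $ i)"
  and of_real_vec_nth [simp]: "of_real_vec a $ i = of_real (a $ i)"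
  by (simp_all add: vcnj_def re_vec_def im_vec_def of_real_vec_def)

lemma vcnj_simps:
  "vcnj (x + y) = vcnj x + vcnj y" "vcnj (x - y) = vcnj x - vcnj y" "vcnj (- x) = - vcnj x"
  "vcnj (r *\<^sub>R x) = r *\<^sub>R vcnj x" "vcnj (vcnj x) = x"
  by (simp_all add: vec_eq_iff)

lemma vcnj_tau: "vcnj (tau x) = tau (vcnj x)"
  by (simp add: vec_sum_eq_iff)

lemma continuous_on_vcnj [continuous_intros]:
  "continuous_on S f \<Longrightarrow> continuous_on S (\<lambda>x. vcnj (f x))"
  unfolding vcnj_def by (intro continuous_intros)

lemma re_im_decomp: "x = of_real_vec (re_vec x) + \<i> *s of_real_vec (im_vec x)"
  by (simp add: vec_eq_iff complex_eq)

text \<open>A complex scalar mixes real and imaginary parts with real coefficients, so the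
  right-hand side is a complex subspace; each of its vectors is a complex combination of two vectors
  from \<open>L\<close>.\<close>

lemma complexification_eq:
  assumes L: "vec.subspace L"
  shows "complexification L = {x. re_vec x \<in> L \<and> im_vec x \<in> L}"
proof
  have "vec.subspace {x. re_vec x \<in> L \<and> im_vec x \<in> L}"
    unfolding vec.subspace_def
  proof (intro conjI ballI allI)
    have [simp]: "re_vec 0 = 0" "im_vec 0 = 0" by (simp_all add: vec_eq_iff)
    show "0 \<in> {x. re_vec x \<in> L \<and> im_vec x \<in> L}" using vec.subspace_0[OF L] by simp
    have "re_vec (x + y) = re_vec x + re_vec y" "im_vec (x + y) = im_vec x + im_vec y" for x y :: "complex ^ 'a"
      by (simp_all add: vec_eq_iff)
    then show "x + y \<in> {x. re_vec x \<in> L \<and> im_vec x \<in> L}"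
      if "x \<in> {x. re_vec x \<in> L \<and> im_vec x \<in> L}" "y \<in> {x. re_vec x \<in> L \<and> im_vec x \<in> L}" for x y
      using that by (simp add: vec.subspace_add[OF L])
    have "re_vec (c *s x) = Re c *s re_vec x - Im c *s im_vec x"
      "im_vec (c *s x) = Re c *s im_vec x + Im c *s re_vec x" for c and x :: "complex ^ 'a"
      by (simp_all add: vec_eq_iff)
    then show "c *s x \<in> {x. re_vec x \<in> L \<and> im_vec x \<in> L}"
      if "x \<in> {x. re_vec x \<in> L \<and> im_vec x \<in> L}" for c x
      using that by (simp add: vec.subspace_add[OF L] vec.subspace_diff[OF L] vec.subspace_scale[OF L])
  qed
  moreover have "of_real_vec ` L \<subseteq> {x. re_vec x \<in> L \<and> im_vec x \<in> L}"
  proof -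
    have "re_vec (of_real_vec a) = a" "im_vec (of_real_vec a) = 0" for a :: "real ^ 'a"
      by (simp_all add: vec_eq_iff)
    then show ?thesis using vec.subspace_0[OF L] by auto
  qed
  ultimately show "complexification L \<subseteq> {x. re_vec x \<in> L \<and> im_vec x \<in> L}"
    unfolding complexification_def by (intro vec.span_minimal)
  show "{x. re_vec x \<in> L \<and> im_vec x \<in> L} \<subseteq> complexification L"
    unfolding complexification_def
    by (auto, subst re_im_decomp, intro vec.span_add vec.span_scale vec.span_base imageI)
qed

text \<open>A real basis of \<open>L\<close> stays independent over the complex numbers, since the
  real and imaginary parts of a complex relation are real relations; and it spans the
  complexification.\<close>

lemma dim_complexification:
  assumes L: "vec.subspace L"
  shows "vec.dim (complexification L) = vec.dim L"
proof -
  obtain B where B: "B \<subseteq> L" "vec.independent B" "L \<subseteq> vec.span B" "card B = vec.dim L"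
    using vec.basis_exists by metis
  have fin: "finite B" using B(2) by (rule vec.finiteI_independent)
  have inj: "inj_on of_real_vec B" by (auto simp: inj_on_def vec_eq_iff)
  have "vec.independent (of_real_vec ` B)"
    unfolding vec.dependent_finite[OF finite_imageI[OF fin]]
  proof
    assume "\<exists>u. (\<exists>v\<in>of_real_vec ` B. u v \<noteq> 0) \<and> (\<Sum>v\<in>of_real_vec ` B. u v *s v) = 0"
    then obtain u b where u: "(\<Sum>v\<in>of_real_vec ` B. u v *s v) = 0" and b: "b \<in> B"
      and nz: "u (of_real_vec b) \<noteq> 0" by blast
    have s: "(\<Sum>b\<in>B. u (of_real_vec b) *s of_real_vec b) = 0"
      using u by (simp add: sum.reindex[OF inj])
    have "(\<Sum>b\<in>B. Re (u (of_real_vec b)) *s b) = re_vec (\<Sum>b\<in>B. u (of_real_vec b) *s of_real_vec b)"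
      "(\<Sum>b\<in>B. Im (u (of_real_vec b)) *s b) = im_vec (\<Sum>b\<in>B. u (of_real_vec b) *s of_real_vec b)"
      by (simp_all add: vec_eq_iff)
    then have "(\<Sum>b\<in>B. Re (u (of_real_vec b)) *s b) = 0" "(\<Sum>b\<in>B. Im (u (of_real_vec b)) *s b) = 0"
      by (simp_all add: s vec_eq_iff)
    from this[THEN vec.independentD[OF B(2) fin subset_refl _ b]]
    show False using nz by (simp add: complex_eq_iff)
  qed
  moreover have "complexification L = vec.span (of_real_vec ` B)"
  proof
    \<comment> \<open>Being a real subspace that contains \<open>B\<close>, this set contains all of
      \<open>L\<close>.\<close>
    have "vec.subspace {a :: real ^ 'a. of_real_vec a \<in> vec.span (of_real_vec ` B)}"
      unfolding vec.subspace_def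
    proof (intro conjI ballI allI)
      have "of_real_vec 0 = (0 :: complex ^ 'a)" by (simp add: vec_eq_iff)
      then show "0 \<in> {a :: real ^ 'a. of_real_vec a \<in> vec.span (of_real_vec ` B)}"
        by (simp add: vec.span_zero)
      have "of_real_vec (a + b) = of_real_vec a + of_real_vec b" for a b :: "real ^ 'a"
        by (simp add: vec_eq_iff)
      then show "a + b \<in> {a. of_real_vec a \<in> vec.span (of_real_vec ` B)}"
        if "a \<in> {a. of_real_vec a \<in> vec.span (of_real_vec ` B)}"
          "b \<in> {a. of_real_vec a \<in> vec.span (of_real_vec ` B)}" for a b
        using that by (simp add: vec.span_add)
      have "of_real_vec (c *s a) = of_real c *s of_real_vec a" for c and a :: "real ^ 'a"
        by (simp add: vec_eq_iff)
      then show "c *s a \<in> {a. of_real_vec a \<in> vec.span (of_real_vec ` B)}"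
        if "a \<in> {a. of_real_vec a \<in> vec.span (of_real_vec ` B)}" for c a
        using that by (simp add: vec.span_scale)
    qed
    then have "vec.span B \<subseteq> {a. of_real_vec a \<in> vec.span (of_real_vec ` B)}"
      by (intro vec.span_minimal) (auto intro: vec.span_base)
    with B(3) show "complexification L \<subseteq> vec.span (of_real_vec ` B)"
      unfolding complexification_def by (intro vec.span_minimal) auto
    show "vec.span (of_real_vec ` B) \<subseteq> complexification L"
      unfolding complexification_def using B(1) by (intro vec.span_mono) auto
  qed
  ultimately show ?thesis
    using B(4) card_image[OF inj] by (simp add: vec.dim_eq_card_independent)
qed

section \<open>The embedding in coordinates\<close>

lemma e_vec_nth [simp]:
  "e_vec j $ Inl i = (if i = j then 1 else 0)" "e_vec j $ Inr i = 0"
  and f_vec_nth [simp]: "f_vec j $ Inl i = 0" "f_vec j $ Inr i = (if i = j then 1 else 0)"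
  by (simp_all add: e_vec_def f_vec_def axis_def)

lemma iota_nth [simp]:
  fixes x :: "complex ^ ('n::finite + 'n)" and i :: "'m::finite"
  shows "(iota x :: complex ^ (('m + 'n) + ('m + 'n))) $ Inl (Inl i) = 0"
    "(iota x :: complex ^ (('m + 'n) + ('m + 'n))) $ Inr (Inl i) = 0"
    "(iota x :: complex ^ (('m + 'n) + ('m + 'n))) $ Inl (Inr j) = x $ Inl j"
    "(iota x :: complex ^ (('m + 'n) + ('m + 'n))) $ Inr (Inr j) = x $ Inr j"
  by (simp_all add: iota_def if_distrib[of "\<lambda>c. _ * c"] cong: if_cong)

lemma vec_sum4_eq_iff:
  fixes x y :: "complex ^ (('m::finite + 'n::finite) + ('m + 'n))"
  shows "x = y \<longleftrightarrow> (\<forall>i. x $ Inl (Inl i) = y $ Inl (Inl i)) \<and> (\<forall>j. x $ Inl (Inr j) = y $ Inl (Inr j)) \<and>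
    (\<forall>i. x $ Inr (Inl i) = y $ Inr (Inl i)) \<and> (\<forall>j. x $ Inr (Inr j) = y $ Inr (Inr j))"
  unfolding vec_sum_eq_iff by (metis sum.exhaust)

lemma iota_simps:
  "iota (x + y) = iota x + iota y" "iota (c *s x) = c *s iota x" "iota (vcnj x) = vcnj (iota x)"
  by (simp_all add: vec_sum4_eq_iff)

lemma omega_iota: "omega (iota x) (iota y) = omega x y"
  by (simp add: omega_def sum_UNIV_sum)

abbreviation e_span :: "(complex ^ (('m::finite + 'n::finite) + ('m + 'n))) set" where
  "e_span \<equiv> vec.span (range (\<lambda>i. e_vec (Inl i)))"

lemma e_span_eq:
  "e_span = {x :: complex ^ (('m::finite + 'n::finite) + ('m + 'n)).
     (\<forall>j. x $ Inl (Inr j) = 0) \<and> (\<forall>i. x $ Inr i = 0)}" (is "_ = ?S")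
proof
  show "e_span \<subseteq> ?S"
    by (rule vec.span_minimal) (auto simp: vec.subspace_def)
  show "?S \<subseteq> e_span"
  proof
    fix x assume "x \<in> ?S"
    then have "x = (\<Sum>i\<in>UNIV. x $ Inl (Inl i) *s e_vec (Inl i))"
      by (simp add: vec_sum4_eq_iff if_distrib[of "\<lambda>c. _ * c"] cong: if_cong)
    also have "\<dots> \<in> e_span" by (intro vec.span_sum vec.span_scale vec.span_base) auto
    finally show "x \<in> e_span" .
  qed
qed

lemma dim_e_span: "vec.dim (e_span :: (complex ^ (('m::finite + 'n::finite) + ('m + 'n))) set) = CARD('m)"
proof -
  have "vec.independent (range (\<lambda>i :: 'm. e_vec (Inl i) :: complex ^ (('m + 'n) + ('m + 'n))))"
    by (rule vec.independent_mono[OF independent_cart_basis]) (auto simp: cart_basis_def e_vec_def)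
  moreover have "inj (\<lambda>i :: 'm. e_vec (Inl i) :: complex ^ (('m + 'n) + ('m + 'n)))"
    by (auto simp: inj_def e_vec_def axis_eq_axis)
  ultimately show ?thesis
    by (simp add: vec.dim_eq_card_independent card_image)
qed

lemma dim_iota_image:
  assumes "vec.subspace S"
  shows "vec.subspace (iota ` S :: (complex ^ (('m::finite + 'n::finite) + ('m + 'n))) set)"
    "vec.dim (iota ` S :: (complex ^ (('m + 'n) + ('m + 'n))) set) = vec.dim S"
proof -
  have lin: "Vector_Spaces.linear (*s) (*s) (iota :: complex ^ ('n + 'n) \<Rightarrow> complex ^ (('m + 'n) + ('m + 'n)))"
    by (simp add: Vector_Spaces.linear_iff vec.vector_space_axioms iota_simps)
  have "inj (iota :: complex ^ ('n + 'n) \<Rightarrow> complex ^ (('m + 'n) + ('m + 'n)))"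
    by (simp add: inj_def vec_sum4_eq_iff) (simp add: vec_sum_eq_iff)
  then show "vec.dim (iota ` S :: (complex ^ (('m + 'n) + ('m + 'n))) set) = vec.dim S"
    using inj_on_subset by (intro vec.dim_image_eq[OF lin]) blast
  show "vec.subspace (iota ` S :: (complex ^ (('m + 'n) + ('m + 'n))) set)"
    using vec.linear_subspace_image[OF lin assms] .
qed

text \<open>The two summands are supported on disjoint sets of coordinates, so the sum is
  direct.\<close>

lemma dim_lag_embed:
  assumes "vec.subspace S"
  shows "vec.subspace (lag_embed S :: (complex ^ (('m::finite + 'n::finite) + ('m + 'n))) set)"
    "vec.dim (lag_embed S :: (complex ^ (('m + 'n) + ('m + 'n))) set) = CARD('m) + vec.dim S"
proof -
  let ?E = "e_span :: (complex ^ (('m + 'n) + ('m + 'n))) set"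
  let ?I = "iota ` S :: (complex ^ (('m + 'n) + ('m + 'n))) set"
  have eq: "lag_embed S = {x + y | x y. x \<in> ?E \<and> y \<in> ?I}"
    unfolding lag_embed_def by blast
  note I = dim_iota_image[OF assms, where 'm = 'm]
  have E: "vec.subspace ?E" by (rule vec.subspace_span)
  have "x = 0" if "x \<in> ?E" "x \<in> ?I" for x
    using that by (auto simp: e_span_eq vec_sum4_eq_iff)
  then have "?E \<inter> ?I = {0}"
    using vec.subspace_0[OF E] vec.subspace_0[OF I(1)] by blast
  then show "vec.dim (lag_embed S :: (complex ^ (('m + 'n) + ('m + 'n))) set) = CARD('m) + vec.dim S"
    using vec.dim_sums_Int[OF E I(1)] I(2) dim_e_span[where 'm = 'm and 'n = 'n] by (simp add: eq)
  show "vec.subspace (lag_embed S :: (complex ^ (('m + 'n) + ('m + 'n))) set)"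
    unfolding eq by (rule vec.subspace_sums[OF E I(1)])
qed

text \<open>The arguments are split into real and imaginary parts one at a time, with antisymmetry
  bringing each of them to the left.\<close>

lemma omega_complexification:
  assumes L: "vec.subspace L" and iso: "\<And>x y. x \<in> L \<Longrightarrow> y \<in> L \<Longrightarrow> omega x y = 0"
    and "x \<in> complexification L" "y \<in> complexification L"
  shows "omega x y = 0"
proof -
  have om: "omega (of_real_vec a) (of_real_vec b) = 0" if "a \<in> L" "b \<in> L" for a b
    using iso[OF that] by (simp add: omega_of_real_vec)
  have left: "omega z (of_real_vec b) = 0" if "re_vec z \<in> L" "im_vec z \<in> L" "b \<in> L" for z b
    by (subst re_im_decomp) (simp add: omega_add_left omega_scale_left om that)
  have "omega (of_real_vec b) x = 0" if "b \<in> L" for b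
    using assms(3) left[of x b] that by (simp add: complexification_eq[OF L] omega_antisym[of _ x])
  then have "omega y x = 0"
    using assms(4) unfolding complexification_eq[OF L]
    by (subst re_im_decomp[of y]) (simp add: omega_add_left omega_scale_left)
  then show ?thesis by (simp add: omega_antisym[of x y])
qed

text \<open>The two conditions on the right translate directly into conditions on the involution.
  For the harder inclusion, pairing with \<open>e_vec (Inl i)\<close> removes the coordinates
  \<open>Inr (Inl i)\<close>, so every vector is an \<open>e_span\<close> part plus an
  \<open>iota\<close> part, and conjugation invariance splits the latter into real and imaginary
  parts without leaving the subspace.\<close>

lemma real_lagrangians_image:
  "(\<lambda>L. lag_embed (complexification L)) ` (lagrangians :: (real ^ ('n::finite + 'n)) set set) =
   {\<Gamma> \<in> lagrangians :: (complex ^ (('m::finite + 'n) + ('m + 'n))) set set.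
      vcnj ` \<Gamma> \<subseteq> \<Gamma> \<and> (\<forall>i. e_vec (Inl i) \<in> \<Gamma>)}"
    (is "?f ` _ = ?G")
proof (intro subset_antisym subsetI)
  fix \<Gamma> assume "\<Gamma> \<in> ?f ` lagrangians"
  then obtain L where \<Gamma>: "\<Gamma> = ?f L" and "L \<in> lagrangians" by blast
  then have L: "vec.subspace L" "vec.dim L = CARD('n)" "\<And>x y. x \<in> L \<Longrightarrow> y \<in> L \<Longrightarrow> omega x y = 0"
    by (auto simp: lagrangians_def)
  have C: "vec.subspace (complexification L)" by (simp add: complexification_def vec.subspace_span)
  have "omega x y = 0" if xy: "x \<in> \<Gamma>" "y \<in> \<Gamma>" for x y
  proof -
    obtain u v u' v' where x: "x = u + iota v" "u \<in> e_span" "v \<in> complexification L"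
      and y: "y = u' + iota v'" "u' \<in> e_span" "v' \<in> complexification L"
      using xy unfolding \<Gamma> lag_embed_def by blast
    \<comment> \<open>Vectors of \<open>e_span\<close> pair to zero with each other and with the
      image of \<open>iota\<close>.\<close>
    have "omega x y = omega v v'"
      using x(2) y(2) by (simp add: x(1) y(1) omega_def sum_UNIV_sum e_span_eq)
    then show ?thesis using omega_complexification[OF L(1,3)] x(3) y(3) by simp
  qed
  then have "\<Gamma> \<in> lagrangians"
    using dim_lag_embed[OF C, where 'm = 'm] L(2) by (simp add: lagrangians_def \<Gamma> dim_complexification[OF L(1)])
  moreover have "vcnj x \<in> \<Gamma>" if x: "x \<in> \<Gamma>" for x
  proof -
    obtain u v where x: "x = u + iota v" "u \<in> e_span" "v \<in> complexification L"
      using x unfolding \<Gamma> lag_embed_def by blast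
    have "re_vec (vcnj v) = re_vec v" "im_vec (vcnj v) = - im_vec v" by (simp_all add: vec_eq_iff)
    then have "vcnj v \<in> complexification L"
      using x(3) vec.subspace_neg[OF L(1)] by (simp add: complexification_eq[OF L(1)])
    moreover have "vcnj u \<in> e_span" using x(2) by (simp add: e_span_eq)
    moreover have "vcnj x = vcnj u + iota (vcnj v)" by (simp add: x(1) vcnj_simps iota_simps)
    ultimately show ?thesis unfolding \<Gamma> lag_embed_def by blast
  qed
  moreover have "e_vec (Inl i) \<in> \<Gamma>" for i
  proof -
    have "e_vec (Inl i) = e_vec (Inl i) + iota (0 :: complex ^ ('n + 'n))" by (simp add: vec_sum4_eq_iff)
    moreover have "e_vec (Inl i) \<in> e_span" by (intro vec.span_base) auto
    ultimately show ?thesis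
      using vec.subspace_0[OF C] unfolding \<Gamma> lag_embed_def by blast
  qed
  ultimately show "\<Gamma> \<in> ?G" by auto
next
  fix \<Gamma> assume "\<Gamma> \<in> ?G"
  then have sub: "vec.subspace \<Gamma>" and dim: "vec.dim \<Gamma> = CARD('m + 'n)"
    and iso: "\<And>x y. x \<in> \<Gamma> \<Longrightarrow> y \<in> \<Gamma> \<Longrightarrow> omega x y = 0"
    and cnj: "\<And>x. x \<in> \<Gamma> \<Longrightarrow> vcnj x \<in> \<Gamma>" and e: "\<And>i. e_vec (Inl i) \<in> \<Gamma>"
    by (auto simp: lagrangians_def)
  have E: "e_span \<subseteq> \<Gamma>" using e by (intro vec.span_minimal sub) auto
  define L where "L = {a :: real ^ ('n + 'n). iota (of_real_vec a) \<in> \<Gamma>}"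
  have L: "vec.subspace L"
    unfolding vec.subspace_def
  proof (intro conjI ballI allI)
    have "iota (of_real_vec (0 :: real ^ ('n + 'n))) = (0 :: complex ^ (('m + 'n) + ('m + 'n)))"
      by (simp add: vec_sum4_eq_iff)
    then show "0 \<in> L" using vec.subspace_0[OF sub] by (simp add: L_def)
    have "iota (of_real_vec (a + b)) = (iota (of_real_vec a) + iota (of_real_vec b) :: complex ^ (('m + 'n) + ('m + 'n)))"
      for a b :: "real ^ ('n + 'n)" by (simp add: vec_sum4_eq_iff)
    then show "a + b \<in> L" if "a \<in> L" "b \<in> L" for a b
      using that vec.subspace_add[OF sub] by (simp add: L_def)
    have "iota (of_real_vec (c *s a)) = (of_real c *s iota (of_real_vec a) :: complex ^ (('m + 'n) + ('m + 'n)))"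
      for c and a :: "real ^ ('n + 'n)" by (simp add: vec_sum4_eq_iff)
    then show "c *s a \<in> L" if "a \<in> L" for c a
      using that vec.subspace_scale[OF sub] by (simp add: L_def)
  qed
  have eq: "\<Gamma> = ?f L"
  proof (intro subset_antisym subsetI)
    fix x assume x: "x \<in> \<Gamma>"
    \<comment> \<open>The shifted block of coordinates of \<open>x\<close>: once the coordinates
      \<open>Inr (Inl i)\<close> are known to vanish, \<open>x\<close> and \<open>iota p\<close>
      differ by an element of \<open>e_span\<close>.\<close>
    define p :: "complex ^ ('n + 'n)" where
      "p = (\<chi> k. case k of Inl j \<Rightarrow> x $ Inl (Inr j) | Inr j \<Rightarrow> x $ Inr (Inr j))"
    have p: "p $ Inl j = x $ Inl (Inr j)" "p $ Inr j = x $ Inr (Inr j)" for j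
      by (simp_all add: p_def)
    have "x $ Inr (Inl i) = 0" for i
    proof -
      have "omega (e_vec (Inl i)) x = x $ Inr (Inl i)"
        by (simp add: omega_def if_distrib[of "\<lambda>c. c * _"] cong: if_cong)
      then show ?thesis using iso[OF e x] by simp
    qed
    then have xp: "x - iota p \<in> e_span"
      by (auto simp: e_span_eq p intro: sum.exhaust) (metis iota_nth(2,4) p(2) sum.exhaust)
    have "x - (x - iota p) \<in> \<Gamma>" by (rule vec.subspace_diff[OF sub x subsetD[OF E xp]])
    then have ip: "iota p \<in> \<Gamma>" by simp
    \<comment> \<open>Both parts are combinations of \<open>iota p\<close> and its conjugate, which
      lie in the subspace.\<close>
    have "iota (of_real_vec (re_vec p)) = (1/2) *s (iota p + vcnj (iota p) :: complex ^ (('m + 'n) + ('m + 'n)))"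
      "iota (of_real_vec (im_vec p)) = (-\<i>/2) *s (iota p - vcnj (iota p) :: complex ^ (('m + 'n) + ('m + 'n)))"
      by (simp_all add: vec_sum4_eq_iff complex_eq_iff)
    then have "re_vec p \<in> L" "im_vec p \<in> L"
      unfolding L_def mem_Collect_eq
      by (metis vec.subspace_scale[OF sub] vec.subspace_add[OF sub] ip cnj,
          metis vec.subspace_scale[OF sub] vec.subspace_diff[OF sub] ip cnj)
    then have "p \<in> complexification L" by (simp add: complexification_eq[OF L])
    moreover have "x = (x - iota p) + iota p" by simp
    ultimately show "x \<in> ?f L" unfolding lag_embed_def using xp by blast
  next
    fix x assume "x \<in> ?f L"
    then obtain u p where x: "x = u + iota p" "u \<in> e_span" "p \<in> complexification L"
      unfolding lag_embed_def by blast
    have p: "re_vec p \<in> L" "im_vec p \<in> L" using x(3) by (simp_all add: complexification_eq[OF L])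
    have "iota p = iota (of_real_vec (re_vec p)) + \<i> *s (iota (of_real_vec (im_vec p)) :: complex ^ (('m + 'n) + ('m + 'n)))"
      by (subst re_im_decomp[of p]) (simp only: iota_simps)
    also have "\<dots> \<in> \<Gamma>"
      using p by (intro vec.subspace_add[OF sub] vec.subspace_scale[OF sub]) (auto simp: L_def)
    finally show "x \<in> \<Gamma>" unfolding x(1) using x(2) E by (intro vec.subspace_add[OF sub]) auto
  qed
  \<comment> \<open>The embedding raises the dimension by exactly \<open>CARD('m)\<close>, so the
    dimension of \<open>L\<close> can be read off.\<close>
  have "vec.dim L = CARD('n)"
  proof -
    have "vec.subspace (complexification L)" by (simp add: complexification_def vec.subspace_span)
    then have "vec.dim \<Gamma> = CARD('m) + vec.dim L"
      unfolding eq by (simp add: dim_lag_embed dim_complexification[OF L])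
    then show ?thesis using dim by simp
  qed
  moreover have "omega a b = 0" if "a \<in> L" "b \<in> L" for a b
  proof -
    have "omega (of_real_vec a) (of_real_vec b) = 0"
      using that iso[of "iota (of_real_vec a)" "iota (of_real_vec b)"] by (simp add: L_def omega_iota)
    then show ?thesis by (simp add: omega_of_real_vec)
  qed
  ultimately have "L \<in> lagrangians" using L by (simp add: lagrangians_def)
  then show "\<Gamma> \<in> ?f ` lagrangians" using eq by blast
qed

section \<open>Invariance under Newton steps\<close>

text \<open>In this form the step is an odd real polynomial in \<open>R\<close>, hence compatible
  with self-adjointness, with anticommutation with \<open>tau\<close> and with conjugation.\<close>

lemma newton_matrix_vector_mult:
  "newton R *v x = (3/2) *\<^sub>R (R *v x) - (1/2) *\<^sub>R (R *v (R *v (R *v x)))"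
proof -
  have "newton R *v x = R *v x + (1/2) *\<^sub>R (R *v x - R *v (R *v (R *v x)))"
    by (simp add: newton_def matrix_vector_mult_add_rdistrib scaleR_matrix_vector_mult
        matrix_vector_mult_diff_rdistrib matrix_vector_mult_diff_distrib flip: matrix_vector_mul_assoc)
  then show ?thesis
    by (simp add: scaleR_diff_right) (simp add: scaleR_left_distrib[of 1, simplified, symmetric])
qed

lemma newton_involution_space: "R \<in> involution_space \<Longrightarrow> newton R \<in> involution_space"
  by (simp add: involution_space_def newton_matrix_vector_mult herm_simps tau_simps vec.neg)

lemma ANR_lag_involutions: "ANR lag_involutions"
  unfolding lag_involutions_def
  by (intro closed_ANR_involutions closed_involution_space convex_involution_space newton_involution_space)

definition real_involution_space :: "(complex ^ (('m::finite + 'n::finite) + ('m + 'n)) ^ (('m + 'n) + ('m + 'n))) set" where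
  "real_involution_space = {R \<in> involution_space.
     (\<forall>x. R *v vcnj x = vcnj (R *v x)) \<and> (\<forall>i. R *v e_vec (Inl i) = e_vec (Inl i))}"

text \<open>Since \<open>vcnj\<close> commutes with \<open>tau\<close>, conjugation invariance of
  the fixed space passes to its \<open>tau\<close> image, so \<open>R\<close> commutes with
  \<open>vcnj\<close> on both summands of the splitting.\<close>

lemma real_lagrangians_involutions:
  "lag_involution ` (\<lambda>L. lag_embed (complexification L)) ` (lagrangians :: (real ^ ('n::finite + 'n)) set set) =
   {R \<in> real_involution_space :: (complex ^ (('m::finite + 'n) + ('m + 'n)) ^ (('m + 'n) + ('m + 'n))) set. R ** R = mat 1}"
    (is "lag_involution ` _ = ?Q")
proof -
  have "(\<forall>x. R *v vcnj x = vcnj (R *v x)) \<longleftrightarrow> vcnj ` fixed_space R \<subseteq> fixed_space R"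
    if R: "R \<in> lag_involutions" for R :: "complex ^ (('m + 'n) + ('m + 'n)) ^ (('m + 'n) + ('m + 'n))"
  proof
    show "vcnj ` fixed_space R \<subseteq> fixed_space R" if "\<forall>x. R *v vcnj x = vcnj (R *v x)"
      using that by (auto simp: fixed_space_def)
    assume *: "vcnj ` fixed_space R \<subseteq> fixed_space R"
    show "\<forall>x. R *v vcnj x = vcnj (R *v x)"
    proof
      fix x
      obtain u where u: "u \<in> fixed_space R" "x - u \<in> tau ` fixed_space R"
        using lagrangian_decomp[OF fixed_space_lagrangian[OF R]] by blast
      then obtain v where v: "x - u = tau v" "v \<in> fixed_space R" by blast
      then have x: "x = u + tau v" by (simp add: algebra_simps)
      have "R *v u = u" "R *v v = v" "R *v vcnj u = vcnj u" "R *v vcnj v = vcnj v"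
        using u v * by (auto simp: fixed_space_def)
      then show "R *v vcnj x = vcnj (R *v x)"
        by (simp add: x matrix_vector_right_distrib lag_involutionsD(2)[OF R] vcnj_simps vcnj_tau)
    qed
  qed
  then have Q: "R \<in> ?Q \<longleftrightarrow> R \<in> lag_involutions \<and> vcnj ` fixed_space R \<subseteq> fixed_space R \<and> (\<forall>i. e_vec (Inl i) \<in> fixed_space R)"
    for R :: "complex ^ (('m + 'n) + ('m + 'n)) ^ (('m + 'n) + ('m + 'n))"
    by (auto simp: real_involution_space_def lag_involutions_def fixed_space_def)
  show ?thesis
    unfolding real_lagrangians_image
  proof (intro subset_antisym subsetI)
    fix R assume "R \<in> ?Q"
    then show "R \<in> lag_involution ` {\<Gamma> \<in> lagrangians. vcnj ` \<Gamma> \<subseteq> \<Gamma> \<and> (\<forall>i :: 'm. e_vec (Inl i) \<in> \<Gamma>)}"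
      unfolding Q
      by (intro image_eqI[of _ _ "fixed_space R"]) (auto simp: fixed_space_lagrangian lag_involution_fixed_space)
  qed (unfold Q, auto simp: lag_involution image_subset_iff)
qed

lemma closed_real_involution_space: "closed real_involution_space"
  unfolding real_involution_space_def Collect_conj_eq Collect_mem_eq
  by (intro closed_Int closed_involution_space closed_Collect_all closed_Collect_eq continuous_intros)

text \<open>Fixing the vectors \<open>e_vec (Inl i)\<close> is an affine condition rather than a
  linear one, so here the weights must add up to 1.\<close>

lemma convex_real_involution_space: "convex real_involution_space"
proof -
  have "u *\<^sub>R z + v *\<^sub>R z = z" if "u + v = 1" for u v and z :: "'x::real_vector"
    using that by (simp flip: scaleR_left_distrib)
  then show ?thesis
    using convex_involution_space
    by (auto simp: convex_def real_involution_space_def matrix_vector_mult_add_rdistrib vcnj_simps scaleR_matrix_vector_mult)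
qed

text \<open>A vector fixed by \<open>R\<close> is fixed by \<open>newton R\<close> because
  \<open>3/2 - 1/2 = 1\<close>.\<close>

lemma newton_real_involution_space: "R \<in> real_involution_space \<Longrightarrow> newton R \<in> real_involution_space"
  by (simp add: real_involution_space_def newton_involution_space newton_matrix_vector_mult vcnj_simps
      flip: scaleR_left_diff_distrib)

theorem corollary20:
  shows "homotopy_extension_property TYPE('b)
    (lagrangian_topology :: (complex ^ (('m::finite + 'n::finite) + ('m + 'n))) set topology)
    ((\<lambda>L. lag_embed (complexification L)) ` (lagrangians :: (real ^ ('n + 'n)) set set))"
proof (rule homotopy_extension_property_compact_ANR[OF homeomorphic_map_lag_involution])
  let ?Q = "{R \<in> real_involution_space :: (complex ^ (('m + 'n) + ('m + 'n)) ^ (('m + 'n) + ('m + 'n))) set. R ** R = mat 1}"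
  \<comment> \<open>In this form \<open>?Q\<close> is visibly a closed part of a compact
    set.\<close>
  have "?Q = lag_involutions \<inter> real_involution_space"
    by (auto simp: lag_involutions_def real_involution_space_def)
  then show "compact (lag_involution ` (\<lambda>L. lag_embed (complexification L)) ` (lagrangians :: (real ^ ('n + 'n)) set set)
      :: (complex ^ (('m + 'n) + ('m + 'n)) ^ (('m + 'n) + ('m + 'n))) set)"
    by (simp add: real_lagrangians_involutions compact_Int_closed compact_lag_involutions closed_real_involution_space)
  show "ANR (lag_involution ` (\<lambda>L. lag_embed (complexification L)) ` (lagrangians :: (real ^ ('n + 'n)) set set)
      :: (complex ^ (('m + 'n) + ('m + 'n)) ^ (('m + 'n) + ('m + 'n))) set)"
    unfolding real_lagrangians_involutions
    by (intro closed_ANR_involutions closed_real_involution_space convex_real_involution_space newton_real_involution_space)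
qed (auto simp: topspace_lagrangian_topology real_lagrangians_image compact_lag_involutions ANR_lag_involutions)

end
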